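(* For every integer $n\ge 1$ there exists a piecewise linear function $F$ on $n+1$ intervals, having exactly $n$ fold points and no jump points (so $F$ is continuous), such that the system $$\dot x=F(x)-y,\qquad \dot y=x$$ has at least $n$ limit cycles. (That is, $n$ is a lower bound for the maximum number of limit cycles of such systems.)
   Context: A piecewise linear function on $n+1$ intervals is a function of the form $$F(x)=ax+b+\sum_{i=1}^n a_i|x-x_i|+\sum_{i=1}^n b_i\,\mathrm{sgn}(x-x_i),$$ with real $a,b,a_i,b_i,x_i$, $(a_i^2+b_i^2)x_i\ne0$ for all $i$, and $x_1<\dots<x_n$. The point $(x_i,F(x_i))$ is a jump point if $F(x_i^-)\ne F(x_i^+)$ (equivalently $b_i\ne0$), and a fold point if $F$ is continuous at $x_i$ but its left and right derivatives at $x_i$ differ (equivalently $b_i=0$, $a_i\neq0$). Here all $b_i=0$ and all $a_i\ne0$, so the vector field is Lipschitz continuous and there are no sliding sets; a limit cycle is a periodic orbit having a neighborhood that contains no other periodic orbit. *)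

theory Defs
  imports "HOL-Analysis.Analysis"
begin

text \<open>
  The knots \<open>\<xi> 1 < \<dots> < \<xi> n\<close> are required to be non-zero and genuine, i.e.
  \<open>\<alpha> i\<close> and \<open>\<beta> i\<close> do not both vanish; both are encoded in the product condition.
\<close>

definition piecewise_linear :: "nat \<Rightarrow> (real \<Rightarrow> real) \<Rightarrow> bool" where
  "piecewise_linear n F \<longleftrightarrow>
    (\<exists>(a::real) (b::real) (\<alpha> :: nat \<Rightarrow> real) (\<beta> :: nat \<Rightarrow> real) (\<xi> :: nat \<Rightarrow> real).
       (\<forall>i\<in>{1..n}. ((\<alpha> i)\<^sup>2 + (\<beta> i)\<^sup>2) * \<xi> i \<noteq> 0) \<and>
       strict_mono_on {1..n} \<xi> \<and>
       (\<forall>x. F x = a * x + b + (\<Sum>i=1..n. \<alpha> i * \<bar>x - \<xi> i\<bar>)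
                            + (\<Sum>i=1..n. \<beta> i * sgn (x - \<xi> i))))"

text \<open>
  For a piecewise linear function all one-sided limits exist, and jump and fold points
  can only occur over the knots, so neither notion needs to refer to the knots.
\<close>

definition jump_points :: "(real \<Rightarrow> real) \<Rightarrow> (real \<times> real) set" where
  "jump_points F = {(x, F x) | x.
     \<exists>l r. (F \<longlongrightarrow> l) (at_left x) \<and> (F \<longlongrightarrow> r) (at_right x) \<and> l \<noteq> r}"

definition fold_points :: "(real \<Rightarrow> real) \<Rightarrow> (real \<times> real) set" where
  "fold_points F = {(x, F x) | x.
     isCont F x \<and>
     (\<exists>l r. (F has_real_derivative l) (at_left x) \<and>
            (F has_real_derivative r) (at_right x) \<and> l \<noteq> r)}"

definition lienard_field :: "(real \<Rightarrow> real) \<Rightarrow> real \<times> real \<Rightarrow> real \<times> real" where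
  "lienard_field F = (\<lambda>(x, y). (F x - y, x))"

definition ode_solution :: "(real \<times> real \<Rightarrow> real \<times> real) \<Rightarrow> (real \<Rightarrow> real \<times> real) \<Rightarrow> bool" where
  "ode_solution V \<gamma> \<longleftrightarrow> (\<forall>t. (\<gamma> has_vector_derivative V (\<gamma> t)) (at t))"

text \<open>Orbits are point sets; equilibria do not count as periodic orbits.\<close>

definition periodic_orbit :: "(real \<times> real \<Rightarrow> real \<times> real) \<Rightarrow> (real \<times> real) set \<Rightarrow> bool" where
  "periodic_orbit V C \<longleftrightarrow>
    (\<exists>\<gamma> T. ode_solution V \<gamma> \<and> T > 0 \<and> (\<forall>t. \<gamma> (t + T) = \<gamma> t) \<and>
           \<not> \<gamma> constant_on UNIV \<and> C = range \<gamma>)"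

definition limit_cycle :: "(real \<times> real \<Rightarrow> real \<times> real) \<Rightarrow> (real \<times> real) set \<Rightarrow> bool" where
  "limit_cycle V C \<longleftrightarrow>
    periodic_orbit V C \<and>
    (\<exists>U. open U \<and> C \<subseteq> U \<and> (\<forall>C'. periodic_orbit V C' \<and> C' \<subseteq> U \<longrightarrow> C' = C))"

end

theory Submission
  imports Defs "HOL-Library.Periodic_Fun"
begin

text \<open>
  With \<open>F x = x q(x)\<close> the radius of the system \<open>x' = F x - y\<close>, \<open>y' = x\<close> satisfies in polar coordinates
  \<open>d (ln r) / d \<theta> = q cos\<^sup>2 \<theta> / (1 - q cos \<theta> sin \<theta>)\<close> with \<open>q = q(r cos \<theta>)\<close>, and the right-hand side is
  increasing in \<open>q\<close>. We take \<open>q = \<epsilon> (1 + 4 (\<Sum>i. (-1)^i h(x / \<xi> i)))\<close> with \<open>h(u) = max 0 (1 - 1/u)\<close> for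
  \<open>u > 0\<close>, knots \<open>\<xi> i\<close> that are extremely far apart, and a tiny \<open>\<epsilon>\<close>. The mean of \<open>q\<close> over a circle then
  changes sign between \<open>\<xi> k\<close> and \<open>\<xi> (k + 1)\<close>, which yields a periodic solution by the intermediate
  value theorem after a Lyapunov-Schmidt reduction. In this annulus \<open>q\<close> is
  monotone in \<open>r\<close> up to a negligible error, so the gap between two solutions changes
  strictly monotonically from turn to turn, and the periodic solution is unique there.
\<close>

subsection \<open>Consequences of the mean value theorem\<close>

text \<open>The hinge is chosen because x h(x/s) is the positive part of x - s, so each hinge adds
  exactly one corner to \<open>F\<close>. The amplitude 4 makes q/\<epsilon> alternate between about
  1 and about -3 on the right half plane; since it equals 1 on the left, the mean alternates between
  about 1 and about -1. The estimates are invariant under scaling, so one \<epsilon> serves all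
  annuli. Two obstacles shape the uniqueness proof. A periodic orbit may a priori close only after
  several turns, so all solutions of period 2 pi m have to be compared. And two solutions in one
  annulus may have very different radii, so linearising along the cycle is not enough. Beyond its
  knot s, a hinge changes along a ray by s times a difference of reciprocals of x, and the
  difference of 1/r between two solutions changes by at most half of itself during one turn. This
  measures all contributions of a turn against one number, while the strict growth or decay is
  recorded by the gap in ln r.\<close>

lemma DERIV_const_diff:
  fixes f g :: "real \<Rightarrow> real"
  assumes "\<And>x. (f has_real_derivative d x) (at x)" "\<And>x. (g has_real_derivative d x) (at x)"
  shows "f x - g x = f y - g y"
  by (rule DERIV_isconst_all[of "\<lambda>x. f x - g x"])
     (auto intro!: derivative_eq_intros assms)

lemma DERIV_ge_imp_diff_ge:
  fixes f :: "real \<Rightarrow> real"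
  assumes "a \<le> b" "\<And>x. a \<le> x \<Longrightarrow> x \<le> b \<Longrightarrow> (f has_real_derivative f' x) (at x)"
    and "\<And>x. a \<le> x \<Longrightarrow> x \<le> b \<Longrightarrow> B \<le> f' x"
  shows "B * (b - a) \<le> f b - f a"
proof -
  have "f a - B * a \<le> f b - B * b"
  proof (rule DERIV_nonneg_imp_nondecreasing[OF \<open>a \<le> b\<close>])
    fix x assume x: "a \<le> x" "x \<le> b"
    show "\<exists>y. ((\<lambda>x. f x - B * x) has_real_derivative y) (at x) \<and> 0 \<le> y"
      using assms(3)[OF x]
      by (intro exI[of _ "f' x - B"]) (auto intro!: derivative_eq_intros assms(2)[OF x])
  qed
  then show ?thesis by (simp add: algebra_simps)
qed

lemma DERIV_bounded_imp_diff_bounded: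
  fixes f :: "real \<Rightarrow> real"
  assumes "\<And>x. a \<le> x \<Longrightarrow> x \<le> b \<Longrightarrow> (f has_real_derivative f' x) (at x)"
    and "\<And>x. a \<le> x \<Longrightarrow> x \<le> b \<Longrightarrow> \<bar>f' x\<bar> \<le> B" and "a \<le> b"
  shows "\<bar>f b - f a\<bar> \<le> B * (b - a)"
proof -
  have "- B * (b - a) \<le> f b - f a"
    by (rule DERIV_ge_imp_diff_ge[OF assms(3,1)]) (use assms(2) in \<open>auto simp: abs_le_iff minus_le_iff\<close>)
  moreover have "- B * (b - a) \<le> - f b - (- f a)"
    by (rule DERIV_ge_imp_diff_ge[OF assms(3), of _ "\<lambda>x. - f' x"])
       (use assms(1,2) in \<open>auto simp: abs_le_iff intro!: derivative_eq_intros\<close>)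
  ultimately show ?thesis by (auto simp: abs_le_iff algebra_simps)
qed

text \<open>A Gronwall estimate without exponentials. If M is the maximum of \<bar>f\<bar>, the mean
  value theorem gives a total variation from \<open>a\<close> of at most M/3, hence M \<le> 3/2
  \<bar>f a\<bar>, and the variation is at most half of \<bar>f a\<bar>.\<close>

lemma linear_growth_bound:
  fixes f :: "real \<Rightarrow> real"
  assumes der: "\<And>x. a \<le> x \<Longrightarrow> x \<le> b \<Longrightarrow> (f has_real_derivative f' x) (at x)"
    and bd: "\<And>x. a \<le> x \<Longrightarrow> x \<le> b \<Longrightarrow> \<bar>f' x\<bar> \<le> L * \<bar>f x\<bar>"
    and L: "L * (b - a) \<le> 1/3" "0 \<le> L" and x: "a \<le> x" "x \<le> b"
  shows "\<bar>f x - f a\<bar> \<le> \<bar>f a\<bar> / 2"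
proof -
  have "continuous_on {a..b} (\<lambda>x. \<bar>f x\<bar>)"
    by (intro continuous_intros continuous_at_imp_continuous_on ballI DERIV_isCont[OF der]) auto
  then obtain z where z: "a \<le> z" "z \<le> b" and max: "\<And>y. a \<le> y \<Longrightarrow> y \<le> b \<Longrightarrow> \<bar>f y\<bar> \<le> \<bar>f z\<bar>"
    using continuous_attains_sup[of "{a..b}" "\<lambda>x. \<bar>f x\<bar>"] x by auto
  have diff: "\<bar>f y - f a\<bar> \<le> \<bar>f z\<bar> / 3" if y: "a \<le> y" "y \<le> b" for y
  proof -
    have "\<bar>f y - f a\<bar> \<le> (L * \<bar>f z\<bar>) * (y - a)"
    proof (rule DERIV_bounded_imp_diff_bounded[OF der])
      fix w assume w: "a \<le> w" "w \<le> y"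
      then have "\<bar>f' w\<bar> \<le> L * \<bar>f w\<bar>" using bd y by auto
      also have "\<dots> \<le> L * \<bar>f z\<bar>" using max[of w] w y L by (intro mult_left_mono) auto
      finally show "\<bar>f' w\<bar> \<le> L * \<bar>f z\<bar>" .
    qed (use y in auto)
    also have "\<dots> \<le> (L * \<bar>f z\<bar>) * (b - a)" using y L by (intro mult_left_mono) auto
    also have "\<dots> = (L * (b - a)) * \<bar>f z\<bar>" by (simp add: algebra_simps)
    also have "\<dots> \<le> (1/3) * \<bar>f z\<bar>" using L by (intro mult_right_mono) auto
    finally show ?thesis by simp
  qed
  show ?thesis using diff[OF x] diff[OF z] by linarith
qed

text \<open>The antiderivative (x + sin x cos x)/2 of the squared cosine has an oscillating part
  that vanishes at the zeros of the cosine. Between two such zeros the squared cosine therefore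
  averages to exactly 1/2.\<close>

lemma DERIV_ge_cos_squared:
  fixes f :: "real \<Rightarrow> real"
  assumes "a \<le> b" "\<And>x. a \<le> x \<Longrightarrow> x \<le> b \<Longrightarrow> (f has_real_derivative f' x) (at x)"
    and "\<And>x. a \<le> x \<Longrightarrow> x \<le> b \<Longrightarrow> A * (cos x)\<^sup>2 + B \<le> f' x"
    and "cos a = 0" "cos b = 0"
  shows "(A / 2 + B) * (b - a) \<le> f b - f a"
proof -
  let ?h = "\<lambda>x. f x - A * ((x + sin x * cos x) / 2)"
  have "B * (b - a) \<le> ?h b - ?h a"
  proof (rule DERIV_ge_imp_diff_ge[OF \<open>a \<le> b\<close>])
    fix x assume x: "a \<le> x" "x \<le> b"
    have "1 + ((cos x)\<^sup>2 - (sin x)\<^sup>2) = 2 * (cos x)\<^sup>2" using sin_squared_eq[of x] by simp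
    then have *: "(1 + (cos x * cos x - sin x * sin x)) / 2 = (cos x)\<^sup>2" by (simp add: power2_eq_square)
    have "((\<lambda>x. A * ((x + sin x * cos x) / 2)) has_real_derivative
        A * ((1 + (cos x * cos x - sin x * sin x)) / 2)) (at x)"
      by (intro DERIV_cmult DERIV_cdivide DERIV_add DERIV_ident) (auto intro!: derivative_eq_intros)
    then show "(?h has_real_derivative f' x - A * (cos x)\<^sup>2) (at x)"
      unfolding * by (intro DERIV_diff assms(2)[OF x])
    show "B \<le> f' x - A * (cos x)\<^sup>2" using assms(3)[OF x] by linarith
  qed
  then have "B * (b - a) \<le> f b - f a - A / 2 * (b - a)" using assms(4,5) by (simp add: field_simps)
  then show ?thesis by (simp add: distrib_right)
qed

section \<open>Antiderivatives, inverse functions and periodicity on the real line\<close>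

lemma ex_antiderivative:
  fixes g :: "real \<Rightarrow> real"
  assumes "continuous_on UNIV g"
  shows "\<exists>P. (\<forall>x. (P has_real_derivative g x) (at x)) \<and> P 0 = 0"
proof -
  have "\<exists>F. \<forall>x::real. - \<infinity> < ereal x \<longrightarrow> ereal x < \<infinity> \<longrightarrow> (F has_vector_derivative g x) (at x)"
    using assms by (intro einterval_antiderivative) (auto simp: continuous_on_eq_continuous_at)
  then obtain F where F: "\<And>x. (F has_real_derivative g x) (at x)"
    by (auto simp: has_real_derivative_iff_has_vector_derivative)
  show ?thesis
    by (rule exI[of _ "\<lambda>x. F x - F 0"]) (auto intro!: derivative_eq_intros F)
qed

definition prim :: "(real \<Rightarrow> real) \<Rightarrow> real \<Rightarrow> real" where
  "prim g = (SOME P. (\<forall>x. (P has_real_derivative g x) (at x)) \<and> P 0 = 0)"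

lemma
  assumes "continuous_on UNIV g"
  shows DERIV_prim: "(prim g has_real_derivative g x) (at x)" and prim_0: "prim g 0 = 0"
  using someI_ex[OF ex_antiderivative[OF assms]] unfolding prim_def by auto

lemma antiderivative_periodic_shift:
  fixes f :: "real \<Rightarrow> real"
  assumes "\<And>x. (f has_real_derivative d x) (at x)" "\<And>x. d (x + p) = d x"
  shows "f (x + p) = f x + (f p - f 0)"
proof -
  have "((\<lambda>x. f (x + p)) has_real_derivative d x) (at x)" for x
    using assms(1)[of "x + p"] DERIV_shift[of f "d (x + p)" x p] by (simp add: assms(2))
  from DERIV_const_diff[OF this assms(1), of x 0] show ?thesis by simp
qed

text \<open>Serves both passages between time and angle: angular speed and its reciprocal are both
  at least 1/2. Growth at this rate makes \<open>f\<close> onto by the intermediate value theorem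
  and its inverse 2-Lipschitz, hence continuous, as the inverse function rule requires.\<close>

lemma inverse_of_increasing:
  fixes f :: "real \<Rightarrow> real"
  assumes der: "\<And>x. (f has_real_derivative f' x) (at x)" and ge: "\<And>x. 1/2 \<le> f' x"
  obtains g where "\<And>x. g (f x) = x" "\<And>y. f (g y) = y"
    "\<And>y. (g has_real_derivative 1 / f' (g y)) (at y)"
proof -
  have grow: "1/2 * (b - a) \<le> f b - f a" if "a \<le> b" for a b
    by (rule DERIV_ge_imp_diff_ge[OF that der ge])
  have inj: "inj f"
  proof (rule linorder_injI)
    fix x y :: real assume "x < y"
    with grow[of x y] show "f x \<noteq> f y" by auto
  qed
  have "\<exists>x. f x = y" for y
  proof -
    define M where "M = 2 * \<bar>y - f 0\<bar>"
    have "f (- M) \<le> y" "y \<le> f M" using grow[of "- M" 0] grow[of 0 M] by (auto simp: M_def)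
    moreover have "- M \<le> M" by (simp add: M_def)
    ultimately show ?thesis
      using IVT[of f "- M" y M] DERIV_isCont[OF der] by auto
  qed
  then have surj: "f (inv f y) = y" for y 
    by (intro f_inv_into_f) (metis rangeI)
  have lip: "\<bar>inv f y - inv f z\<bar> \<le> 2 * \<bar>y - z\<bar>" for y z
    using grow[of "inv f y" "inv f z"] grow[of "inv f z" "inv f y"]
    by (cases "inv f y \<le> inv f z") (simp_all add: surj)
  have "isCont (inv f) y" for y
  proof -
    have "2-lipschitz_on UNIV (inv f)" by (rule lipschitz_onI) (use lip in \<open>auto simp: dist_real_def\<close>)
    then show ?thesis using lipschitz_on_continuous_on[of 2 UNIV "inv f"] by (simp add: continuous_on_eq_continuous_at)
  qed
  then have "(inv f has_real_derivative inverse (f' (inv f y))) (at y)" for y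
    using ge[of "inv f y"]
    by (intro DERIV_inverse_function[OF der, of "inv f" y "y - 1" "y + 1"]) (auto simp: surj)
  then show ?thesis using that[of "inv f"] inj surj by (simp add: divide_inverse)
qed

lemma periodic_reduce:
  fixes f :: "real \<Rightarrow> 'a"
  assumes "\<And>x. f (x + p) = f x" "0 < p"
  obtains y where "0 \<le> y" "y < p" "f y = f x"
proof -
  interpret periodic_fun_simple f p by standard (rule assms)
  let ?k = "\<lfloor>x / p\<rfloor>"
  have "f (x - of_int ?k * p) = f x" by (rule minus_of_int)
  moreover have "of_int ?k * p \<le> x" "x < (of_int ?k + 1) * p"
    using assms(2) by (simp_all add: floor_divide_lower floor_divide_upper)
  ultimately show ?thesis using that[of "x - of_int ?k * p"] by (simp add: algebra_simps)
qed

subsection \<open>Periodic solutions with a mean-value correction\<close>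

text \<open>The antiderivative with value \<open>c\<close> at 0 of \<open>g\<close> minus its mean
  over one period. Removing the mean is what keeps it periodic.\<close>

definition periodic_prim :: "real \<Rightarrow> (real \<Rightarrow> real) \<Rightarrow> real \<Rightarrow> real" where
  "periodic_prim c g \<theta> = c + prim g \<theta> - \<theta> * (prim g (2 * pi) / (2 * pi))"

lemma DERIV_periodic_prim:
  assumes "continuous_on UNIV g"
  shows "(periodic_prim c g has_real_derivative g \<theta> - prim g (2 * pi) / (2 * pi)) (at \<theta>)"
  unfolding periodic_prim_def by (auto intro!: derivative_eq_intros DERIV_prim assms)

lemma periodic_prim_periodic:
  assumes "continuous_on UNIV g" "\<And>\<theta>. g (\<theta> + 2 * pi) = g \<theta>"
  shows "periodic_prim c g (\<theta> + 2 * pi) = periodic_prim c g \<theta>"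
  using antiderivative_periodic_shift[of "prim g" g "2 * pi" \<theta>, OF DERIV_prim[OF assms(1)] assms(2)]
  by (simp add: periodic_prim_def prim_0[OF assms(1)] field_simps)

lemma prim_diff_le:
  assumes "continuous_on UNIV g1" "continuous_on UNIV g2" "\<And>\<theta>. \<bar>g1 \<theta> - g2 \<theta>\<bar> \<le> B"
    and "0 \<le> \<theta>"
  shows "\<bar>prim g1 \<theta> - prim g2 \<theta>\<bar> \<le> B * \<theta>"
  using DERIV_bounded_imp_diff_bounded[of 0 \<theta> "\<lambda>x. prim g1 x - prim g2 x" "\<lambda>x. g1 x - g2 x" B]
  by (auto intro!: derivative_eq_intros DERIV_prim assms simp: prim_0 assms(1,2))

text \<open>By periodicity one turn suffices. There the antiderivatives differ by at most 2 pi B,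
  and so do the linear terms that remove the means.\<close>

lemma periodic_prim_diff_le:
  assumes "continuous_on UNIV g1" "\<And>\<theta>. g1 (\<theta> + 2 * pi) = g1 \<theta>"
    and "continuous_on UNIV g2" "\<And>\<theta>. g2 (\<theta> + 2 * pi) = g2 \<theta>"
    and B: "\<And>\<theta>. \<bar>g1 \<theta> - g2 \<theta>\<bar> \<le> B"
  shows "\<bar>periodic_prim c1 g1 \<theta> - periodic_prim c2 g2 \<theta>\<bar> \<le> \<bar>c1 - c2\<bar> + 4 * pi * B"
proof -
  let ?D = "\<lambda>\<theta>. periodic_prim c1 g1 \<theta> - periodic_prim c2 g2 \<theta>"
  obtain t where t: "0 \<le> t" "t < 2 * pi" "?D t = ?D \<theta>"
    by (rule periodic_reduce[of ?D "2 * pi" \<theta>]) (auto simp: periodic_prim_periodic assms)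
  let ?d = "\<lambda>\<theta>. prim g1 \<theta> - prim g2 \<theta>"
  have "0 \<le> B" using B[of 0] by linarith
  have d: "\<bar>?d s\<bar> \<le> B * (2 * pi)" if "0 \<le> s" "s \<le> 2 * pi" for s
    using prim_diff_le[OF assms(1,3) B that(1)] that \<open>0 \<le> B\<close>
    by (meson mult_left_mono order_trans)
  have "?D t = (c1 - c2) + ?d t - (t / (2 * pi)) * ?d (2 * pi)"
    by (simp add: periodic_prim_def field_simps)
  moreover have "\<bar>(t / (2 * pi)) * ?d (2 * pi)\<bar> \<le> 1 * (B * (2 * pi))"
    unfolding abs_mult using d[of "2 * pi"] t by (intro mult_mono) auto
  ultimately have "\<bar>?D t\<bar> \<le> \<bar>c1 - c2\<bar> + B * (2 * pi) + B * (2 * pi)"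
    using d[of t] t by linarith
  then show ?thesis by (simp add: t(3) algebra_simps)
qed

lemma periodic_prim_near:
  assumes "continuous_on UNIV g" "\<And>\<theta>. g (\<theta> + 2 * pi) = g \<theta>" "\<And>\<theta>. \<bar>g \<theta>\<bar> \<le> B"
  shows "\<bar>periodic_prim c g \<theta> - c\<bar> \<le> 4 * pi * B"
proof -
  have "prim (\<lambda>_. 0) x = 0" for x
    using DERIV_const_diff[of "prim (\<lambda>_. 0)" "\<lambda>_. 0" "\<lambda>_. 0" x 0]
      DERIV_prim[of "\<lambda>_. 0"] prim_0[of "\<lambda>_. 0"] by simp
  then show ?thesis
    using periodic_prim_diff_le[of g "\<lambda>_. 0" B c \<theta> c] assms by (simp add: periodic_prim_def)
qed

text \<open>The bound \<open>q_ratio\<close> is stated with 1 - exp (a - b) because it then yields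
  two Lipschitz estimates at once: one in the logarithm of the radius, and, after multiplication by
  exp (-a), one in the reciprocal radius. The size of \<tau> makes the fixed point map a contraction
  and keeps its fixed points within 1/100 of the constant \<open>c\<close>.\<close>

locale small_ratio =
  fixes q :: "real \<Rightarrow> real" and \<tau> :: real
  assumes tau: "\<tau> \<le> 1/5000"
    and q_bound: "\<bar>q x\<bar> \<le> \<tau>"
    and q_ratio: "a \<le> b \<Longrightarrow> \<bar>q (exp a * c) - q (exp b * c)\<bar> \<le> \<tau> * (1 - exp (a - b))"
    and q_cont: "continuous_on UNIV q"
begin

text \<open>The angular velocity of the system at the point with logarithmic radius \<rho> and angle
  \<theta>.\<close>

definition speed :: "real \<Rightarrow> real \<Rightarrow> real" where
  "speed \<rho> \<theta> = 1 - q (exp \<rho> * cos \<theta>) * cos \<theta> * sin \<theta>"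

definition rhs :: "real \<Rightarrow> real \<Rightarrow> real" where
  "rhs \<rho> \<theta> = q (exp \<rho> * cos \<theta>) * (cos \<theta>)\<^sup>2 / speed \<rho> \<theta>"

lemma tau_nonneg: "0 \<le> \<tau>"
  using q_bound[of 0] by linarith

lemma q_lip: "\<bar>q (exp a * c) - q (exp b * c)\<bar> \<le> \<tau> * \<bar>a - b\<bar>"
proof -
  have *: "\<bar>q (exp a * c) - q (exp b * c)\<bar> \<le> \<tau> * (b - a)" if "a \<le> b" for a b
  proof -
    have "1 - exp (a - b) \<le> b - a" using exp_ge_add_one_self[of "a - b"] by linarith
    then have "\<tau> * (1 - exp (a - b)) \<le> \<tau> * (b - a)" using tau_nonneg by (rule mult_left_mono)
    with q_ratio[OF that, of c] show ?thesis by linarith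
  qed
  show ?thesis using *[of a b] *[of b a] by (cases "a \<le> b") (simp_all add: abs_minus_commute)
qed

lemma abs_mult_cos_sin_le: "\<bar>a * cos t * sin t\<bar> \<le> \<bar>a\<bar>" for a t :: real
proof -
  have "\<bar>a\<bar> * (\<bar>cos t\<bar> * \<bar>sin t\<bar>) \<le> \<bar>a\<bar> * (1 * 1)"
    by (intro mult_left_mono mult_mono) auto
  then show ?thesis by (simp add: abs_mult mult.assoc)
qed

lemma speed_bounds: "1 - \<tau> \<le> speed \<rho> \<theta>" "speed \<rho> \<theta> \<le> 1 + \<tau>"
  using abs_mult_cos_sin_le[of "q (exp \<rho> * cos \<theta>)" \<theta>] q_bound[of "exp \<rho> * cos \<theta>"]
  unfolding speed_def by linarith+

lemma speed_pos: "0 < speed \<rho> \<theta>"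
  using speed_bounds(1)[of \<rho> \<theta>] tau by linarith

lemma speed_prod_bounds:
  "1/2 \<le> 1 / (speed a \<theta> * speed b \<theta>)" "1 / (speed a \<theta> * speed b \<theta>) \<le> 2"
proof -
  have "speed a \<theta> * speed b \<theta> \<le> (5001/5000) * (5001/5000)"
    using speed_bounds[of a \<theta>] speed_bounds[of b \<theta>] tau speed_pos[of b \<theta>]
    by (intro mult_mono) auto
  moreover have "(4999/5000) * (4999/5000) \<le> speed a \<theta> * speed b \<theta>"
    using speed_bounds[of a \<theta>] speed_bounds[of b \<theta>] tau by (intro mult_mono) auto
  ultimately show "1/2 \<le> 1 / (speed a \<theta> * speed b \<theta>)" "1 / (speed a \<theta> * speed b \<theta>) \<le> 2"
    using speed_pos[of a \<theta>] speed_pos[of b \<theta>] by (auto simp: field_simps)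
qed

text \<open>Over the common denominator the products of the two values of \<open>q\<close> cancel,
  so the difference of the values of \<open>q\<close> remains with a positive factor: this is the
  monotonicity in \<open>q\<close>.\<close>

lemma rhs_diff:
  "rhs a \<theta> - rhs b \<theta> =
    (q (exp a * cos \<theta>) - q (exp b * cos \<theta>)) * (cos \<theta>)\<^sup>2 * (1 / (speed a \<theta> * speed b \<theta>))"
  using speed_pos[of a \<theta>] speed_pos[of b \<theta>]
  unfolding rhs_def by (simp add: field_simps) (simp add: speed_def algebra_simps)

lemma rhs_diff_le: "\<bar>rhs a \<theta> - rhs b \<theta>\<bar> \<le> 2 * \<bar>q (exp a * cos \<theta>) - q (exp b * cos \<theta>)\<bar>"
proof -
  have "\<bar>rhs a \<theta> - rhs b \<theta>\<bar> \<le> \<bar>q (exp a * cos \<theta>) - q (exp b * cos \<theta>)\<bar> * 1 * 2"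
    unfolding rhs_diff abs_mult using speed_prod_bounds[of a \<theta> b]
    by (intro mult_mono) (auto simp: abs_square_le_1)
  then show ?thesis by simp
qed

lemma rhs_lip: "\<bar>rhs a \<theta> - rhs b \<theta>\<bar> \<le> 2 * \<tau> * \<bar>a - b\<bar>"
  using order_trans[OF rhs_diff_le mult_left_mono[OF q_lip, of 2 a "cos \<theta>" b]] by (simp add: mult.assoc)

lemma rhs_bound: "\<bar>rhs \<rho> \<theta>\<bar> \<le> 2 * \<tau>"
proof -
  have "\<bar>rhs \<rho> \<theta>\<bar> \<le> \<tau> * 1 * 2"
    unfolding rhs_def divide_inverse abs_mult
    using speed_bounds[of \<rho> \<theta>] tau tau_nonneg speed_pos[of \<rho> \<theta>]
    by (intro mult_mono) (auto simp: abs_square_le_1 q_bound field_simps)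
  then show ?thesis by simp
qed

lemma continuous_on_rhs [continuous_intros]:
  assumes "continuous_on UNIV f"
  shows "continuous_on UNIV (\<lambda>\<theta>. rhs (f \<theta>) \<theta>)"
proof -
  have "speed a b \<noteq> 0" for a b using speed_pos[of a b] by linarith
  moreover have "continuous_on UNIV (\<lambda>\<theta>. q (exp (f \<theta>) * cos \<theta>))"
    by (rule continuous_on_compose2[OF q_cont]) (auto intro!: continuous_intros assms)
  ultimately show ?thesis
    unfolding rhs_def speed_def by (intro continuous_intros) (auto simp: speed_def)
qed

lemma rhs_periodic: "rhs \<rho> (\<theta> + 2 * pi) = rhs \<rho> \<theta>"
  by (simp add: rhs_def speed_def)

text \<open>Banach's fixed point theorem in the closed set of periodic functions, under the supremum
  norm; the contraction factor is 8 pi \<tau>. Subtracting the mean of the right-hand side makes the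
  equation solvable for every \<open>c\<close>, whether or not there is a true periodic solution
  near \<open>c\<close>.\<close>

lemma ex_corrected_solution:
  "\<exists>\<rho>. continuous_on UNIV \<rho> \<and> (\<forall>\<theta>. \<rho> (\<theta> + 2 * pi) = \<rho> \<theta>) \<and>
     \<rho> = periodic_prim c (\<lambda>\<theta>. rhs (\<rho> \<theta>) \<theta>)"
proof -
  define g where "g f = (\<lambda>\<theta>. rhs (apply_bcontfun f \<theta>) \<theta>)" for f
  define S where "S = {f :: real \<Rightarrow>\<^sub>C real. \<forall>\<theta>. f (\<theta> + 2 * pi) = f \<theta>}"
  \<comment> \<open>\<open>Bcontfun\<close> is meaningful only for bounded continuous functions; for
    \<open>f\<close> in \<open>S\<close> periodicity supplies the bound.\<close>
  define P where "P f = Bcontfun (periodic_prim c (g f))" for f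
  have g_cont: "continuous_on UNIV (g f)" for f
    unfolding g_def by (intro continuous_intros continuous_on_apply_bcontfun)
  have g_per: "g f (\<theta> + 2 * pi) = g f \<theta>" if "f \<in> S" for f \<theta>
    using that by (simp add: g_def S_def rhs_periodic)
  have P: "apply_bcontfun (P f) = periodic_prim c (g f)" if "f \<in> S" for f
    unfolding P_def
  proof (rule Bcontfun_inverse[OF bcontfun_normI])
    show "continuous_on UNIV (periodic_prim c (g f))"
      by (intro continuous_at_imp_continuous_on ballI DERIV_isCont[OF DERIV_periodic_prim] g_cont)
    fix \<theta>
    have "\<bar>periodic_prim c (g f) \<theta> - c\<bar> \<le> 4 * pi * (2 * \<tau>)"
      by (rule periodic_prim_near[OF g_cont g_per[OF that]]) (simp add: g_def rhs_bound)
    then show "norm (periodic_prim c (g f) \<theta>) \<le> \<bar>c\<bar> + 4 * pi * (2 * \<tau>)" by simp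
  qed
  have "closed S"
  proof -
    have "closed {f :: real \<Rightarrow>\<^sub>C real. f (\<theta> + 2 * pi) = f \<theta>}" for \<theta>
      unfolding closed_sequential_limits
    proof safe
      fix u and l :: "real \<Rightarrow>\<^sub>C real"
      assume u: "\<forall>n. u n \<in> {f :: real \<Rightarrow>\<^sub>C real. f (\<theta> + 2 * pi) = f \<theta>}" and l: "u \<longlonglongrightarrow> l"
      have lim: "(\<lambda>n. u n s) \<longlonglongrightarrow> l s" for s
        using l unfolding lim_sequentially by (meson dist_bounded order_le_less_trans)
      show "l (\<theta> + 2 * pi) = l \<theta>"
        using LIMSEQ_unique[OF lim[of "\<theta> + 2 * pi"]] lim[of \<theta>] u by simp
    qed
    moreover have "S = (\<Inter>\<theta>. {f :: real \<Rightarrow>\<^sub>C real. f (\<theta> + 2 * pi) = f \<theta>})" by (auto simp: S_def)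
    ultimately show ?thesis by auto
  qed
  have "\<exists>!f\<in>S. P f = f"
  proof (rule Banach_fix[where c = "1/2"])
    show "complete S" using \<open>closed S\<close> by (simp add: complete_eq_closed)
    show "S \<noteq> {}" using const_bcontfun.rep_eq by (auto simp: S_def intro!: exI[of _ "const_bcontfun 0"])
    show "P ` S \<subseteq> S"
      using P periodic_prim_periodic[OF g_cont g_per] by (auto simp: S_def)
    fix f h assume fh: "f \<in> S" "h \<in> S"
    show "dist (P f) (P h) \<le> 1/2 * dist f h"
    proof (rule dist_bound)
      fix \<theta>
      have "\<bar>g f s - g h s\<bar> \<le> 2 * \<tau> * dist f h" for s
      proof -
        have "\<bar>g f s - g h s\<bar> \<le> 2 * \<tau> * dist (f s) (h s)"
          unfolding g_def dist_real_def by (rule rhs_lip)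
        also have "\<dots> \<le> 2 * \<tau> * dist f h"
          using tau_nonneg by (intro mult_left_mono dist_bounded) auto
        finally show ?thesis .
      qed
      from periodic_prim_diff_le[OF g_cont g_per[OF fh(1)] g_cont g_per[OF fh(2)] this, of c \<theta> c]
      have "dist (P f \<theta>) (P h \<theta>) \<le> (8 * pi * \<tau>) * dist f h"
        by (simp add: P fh dist_real_def)
      also have "8 * pi * \<tau> \<le> 8 * 4 * (1/5000)"
        using tau tau_nonneg pi_less_4 by (intro mult_mono) auto
      then have "(8 * pi * \<tau>) * dist f h \<le> 1/2 * dist f h"
        by (intro mult_right_mono) auto
      finally show "dist (P f \<theta>) (P h \<theta>) \<le> 1/2 * dist f h" .
    qed
  qed auto
  then obtain f where "f \<in> S" "P f = f" by auto
  then have "apply_bcontfun f = periodic_prim c (g f)" using P by metis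
  then show ?thesis
    using \<open>f \<in> S\<close> by (intro exI[of _ "apply_bcontfun f"]) (auto simp: S_def g_def)
qed

text \<open>The reduction to one scalar equation: \<open>m c\<close> is the mean of the right-hand
  side along \<rho> c, and a zero of \<open>m\<close> turns \<rho> c into a genuine periodic
  solution. Continuity of \<open>m\<close> is what the intermediate value theorem will use.\<close>

lemma corrected_solutions:
  obtains \<rho> :: "real \<Rightarrow> real \<Rightarrow> real" and m :: "real \<Rightarrow> real" where
    "continuous_on UNIV m"
    "\<And>c \<theta>. \<rho> c (\<theta> + 2 * pi) = \<rho> c \<theta>"
    "\<And>c \<theta>. (\<rho> c has_real_derivative rhs (\<rho> c \<theta>) \<theta> - m c) (at \<theta>)"
    "\<And>c \<theta>. \<bar>\<rho> c \<theta> - c\<bar> \<le> 1/100"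
proof -
  obtain \<rho> where cont: "\<And>c. continuous_on UNIV (\<rho> c)"
    and per: "\<And>c \<theta>. \<rho> c (\<theta> + 2 * pi) = \<rho> c \<theta>"
    and fix_eq: "\<And>c. \<rho> c = periodic_prim c (\<lambda>\<theta>. rhs (\<rho> c \<theta>) \<theta>)"
    using ex_corrected_solution by metis
  define g where "g c = (\<lambda>\<theta>. rhs (\<rho> c \<theta>) \<theta>)" for c
  define m where "m c = prim (g c) (2 * pi) / (2 * pi)" for c
  have g_cont: "continuous_on UNIV (g c)" for c
    unfolding g_def by (intro continuous_intros cont)
  have g_per: "g c (\<theta> + 2 * pi) = g c \<theta>" for c \<theta>
    by (simp add: g_def rhs_periodic per)
  have fix_eq': "\<rho> c = periodic_prim c (g c)" for c
    unfolding g_def by (rule fix_eq)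
  have small: "8 * pi * \<tau> \<le> 1/100"
  proof -
    have "8 * pi * \<tau> \<le> 8 * 4 * (1/5000)"
      using tau tau_nonneg pi_less_4 by (intro mult_mono) auto
    then show ?thesis by simp
  qed
  have der: "(\<rho> c has_real_derivative rhs (\<rho> c \<theta>) \<theta> - m c) (at \<theta>)" for c \<theta>
    using DERIV_periodic_prim[OF g_cont, of c c \<theta>]
    unfolding fix_eq'[symmetric] m_def[symmetric] by (simp add: g_def)
  have near: "\<bar>\<rho> c \<theta> - c\<bar> \<le> 1/100" for c \<theta>
  proof -
    have "\<bar>periodic_prim c (g c) \<theta> - c\<bar> \<le> 4 * pi * (2 * \<tau>)"
      by (rule periodic_prim_near[OF g_cont g_per]) (simp add: g_def rhs_bound)
    then show ?thesis using small by (simp flip: fix_eq')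
  qed
  have lip_m: "\<bar>m a - m b\<bar> \<le> 2 * \<bar>a - b\<bar>" for a b
  proof -
    \<comment> \<open>The supremum is finite since both functions stay near their constants. The
      fixed point equation bounds \<open>D\<close> by \<bar>a - b\<bar> plus a hundredth of
      \<open>D\<close> itself, which can be absorbed.\<close>
    define D where "D = (SUP \<theta>. \<bar>\<rho> a \<theta> - \<rho> b \<theta>\<bar>)"
    have le: "\<bar>\<rho> a \<theta> - \<rho> b \<theta>\<bar> \<le> \<bar>a - b\<bar> + 1/50" for \<theta>
      using near[of a \<theta>] near[of b \<theta>] by linarith
    then have bdd: "bdd_above (range (\<lambda>\<theta>. \<bar>\<rho> a \<theta> - \<rho> b \<theta>\<bar>))" by (auto intro!: bdd_aboveI)
    have D: "\<bar>\<rho> a \<theta> - \<rho> b \<theta>\<bar> \<le> D" for \<theta>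
      unfolding D_def by (rule cSUP_upper[OF _ bdd]) auto
    then have "0 \<le> D" using D[of 0] by linarith
    have gB: "\<bar>g a \<theta> - g b \<theta>\<bar> \<le> 2 * \<tau> * D" for \<theta>
      using rhs_lip[of "\<rho> a \<theta>" \<theta> "\<rho> b \<theta>"] mult_left_mono[OF D[of \<theta>], of "2 * \<tau>"] tau_nonneg
      by (simp add: g_def)
    have "\<bar>\<rho> a \<theta> - \<rho> b \<theta>\<bar> \<le> \<bar>a - b\<bar> + (8 * pi * \<tau>) * D" for \<theta>
      using periodic_prim_diff_le[OF g_cont g_per g_cont g_per gB, of a \<theta> b] 
      unfolding fix_eq'[symmetric] by (simp add: mult.assoc)
    then have "D \<le> \<bar>a - b\<bar> + (8 * pi * \<tau>) * D" unfolding D_def by (intro cSUP_least) auto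
    also have "\<dots> \<le> \<bar>a - b\<bar> + (1/100) * D" using small \<open>0 \<le> D\<close> by (intro add_left_mono mult_right_mono)
    finally have "D \<le> 2 * \<bar>a - b\<bar>" using \<open>0 \<le> D\<close> by argo
    have "\<bar>m a - m b\<bar> = \<bar>prim (g a) (2 * pi) - prim (g b) (2 * pi)\<bar> / (2 * pi)"
      by (simp add: m_def field_simps flip: diff_divide_distrib)
    also have "\<dots> \<le> (2 * \<tau> * D) * (2 * pi) / (2 * pi)"
      by (intro divide_right_mono prim_diff_le g_cont gB) auto
    also have "\<dots> = 2 * \<tau> * D" by simp
    also have "\<dots> \<le> 1 * D" using tau \<open>0 \<le> D\<close> by (intro mult_right_mono) auto
    finally show ?thesis using \<open>D \<le> 2 * \<bar>a - b\<bar>\<close> by linarith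
  qed
  have "2-lipschitz_on UNIV m" by (rule lipschitz_onI) (use lip_m in \<open>auto simp: dist_real_def\<close>)
  then have "continuous_on UNIV m" by (rule lipschitz_on_continuous_on)
  with per der near that show ?thesis by blast
qed

end

subsection \<open>Periodic orbits in polar coordinates\<close>

definition polar :: "(real \<Rightarrow> real) \<Rightarrow> real \<Rightarrow> real \<times> real" where
  "polar \<rho> \<theta> = (exp (\<rho> \<theta>) * cos \<theta>, exp (\<rho> \<theta>) * sin \<theta>)"

lemma norm_polar: "norm (polar \<rho> \<theta>) = exp (\<rho> \<theta>)"
proof -
  have "(exp (\<rho> \<theta>) * cos \<theta>)\<^sup>2 + (exp (\<rho> \<theta>) * sin \<theta>)\<^sup>2 = (exp (\<rho> \<theta>))\<^sup>2 * ((cos \<theta>)\<^sup>2 + (sin \<theta>)\<^sup>2)"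
    by (simp only: power_mult_distrib distrib_left)
  then show ?thesis by (simp add: polar_def norm_Pair)
qed

lemma rotation_solve:
  fixes x y c s e :: real
  assumes "x * c + y * s = e" "y * c - x * s = 0" "c * c + s * s = 1"
  shows "x = e * c" "y = e * s"
proof -
  have "x * (c * c + s * s) = (x * c + y * s) * c - (y * c - x * s) * s"
    by (simp add: algebra_simps)
  then show "x = e * c" unfolding assms by simp
  have "y * (c * c + s * s) = (x * c + y * s) * s + (y * c - x * s) * c"
    by (simp add: algebra_simps)
  then show "y = e * s" unfolding assms by simp
qed

context small_ratio
begin

text \<open>Time is recovered as the integral of the reciprocal angular speed over the angle; its
  inverse reparametrises the polar curve into a solution, whose period is the time of one full
  turn.\<close>

lemma periodic_orbit_polar:
  assumes der: "\<And>\<theta>. (\<rho> has_real_derivative rhs (\<rho> \<theta>) \<theta>) (at \<theta>)"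
    and per: "\<And>\<theta>. \<rho> (\<theta> + 2 * pi) = \<rho> \<theta>"
  shows "periodic_orbit (lienard_field (\<lambda>x. x * q x)) (range (polar \<rho>))"
proof -
  define w where "w \<theta> = 1 / speed (\<rho> \<theta>) \<theta>" for \<theta>
  have \<rho>_cont: "continuous_on UNIV \<rho>"
    by (intro continuous_at_imp_continuous_on ballI DERIV_isCont[OF der])
  have w_cont: "continuous_on UNIV w"
  proof -
    have "speed a b \<noteq> 0" for a b using speed_pos[of a b] by linarith
    moreover have "continuous_on UNIV (\<lambda>\<theta>. q (exp (\<rho> \<theta>) * cos \<theta>))"
      by (rule continuous_on_compose2[OF q_cont]) (auto intro!: continuous_intros \<rho>_cont)
    ultimately show ?thesis
      unfolding w_def speed_def by (intro continuous_intros) (auto simp: speed_def)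
  qed
  have w_ge: "1/2 \<le> w \<theta>" for \<theta>
    using speed_bounds(2)[of "\<rho> \<theta>" \<theta>] speed_pos[of "\<rho> \<theta>" \<theta>] tau by (simp add: w_def field_simps)
  have w_per: "w (\<theta> + 2 * pi) = w \<theta>" for \<theta>
    by (simp add: w_def speed_def per)
  define time where "time = prim w"
  have time_der: "(time has_real_derivative w \<theta>) (at \<theta>)" for \<theta>
    unfolding time_def by (rule DERIV_prim[OF w_cont])
  obtain s where s: "\<And>\<theta>. s (time \<theta>) = \<theta>" "\<And>t. time (s t) = t"
    and s_der: "\<And>t. (s has_real_derivative 1 / w (s t)) (at t)"
    using inverse_of_increasing[OF time_der w_ge] by blast
  define T where "T = time (2 * pi)"
  have time_per: "time (\<theta> + 2 * pi) = time \<theta> + T" for \<theta>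
    using antiderivative_periodic_shift[OF time_der w_per] prim_0[OF w_cont]
    by (simp add: T_def time_def)
  have "1/2 * (2 * pi - 0) \<le> time (2 * pi) - time 0"
    by (rule DERIV_ge_imp_diff_ge[OF _ time_der w_ge]) auto
  then have "pi \<le> T" using prim_0[OF w_cont] by (simp add: T_def time_def)
  then have "0 < T" using pi_gt_zero by linarith
  have s_per: "s (t + T) = s t + 2 * pi" for t
    using s(1)[of "s t + 2 * pi"] time_per[of "s t"] s(2)[of t] by simp
  define \<gamma> where "\<gamma> t = polar \<rho> (s t)" for t
  have "ode_solution (lienard_field (\<lambda>x. x * q x)) \<gamma>"
    unfolding ode_solution_def
  proof
    fix t
    let ?\<theta> = "s t" and ?r = "exp (\<rho> (s t))" and ?x = "exp (\<rho> (s t)) * cos (s t)"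
    let ?v = "speed (\<rho> (s t)) (s t)"
    have s': "(s has_real_derivative ?v) (at t)" using s_der[of t] by (simp add: w_def)
    have rv: "rhs (\<rho> ?\<theta>) ?\<theta> * ?v = q ?x * (cos ?\<theta>)\<^sup>2"
      using speed_pos[of "\<rho> ?\<theta>" ?\<theta>] by (simp add: rhs_def)
    have rad: "((\<lambda>t. \<rho> (s t)) has_real_derivative q ?x * (cos ?\<theta>)\<^sup>2) (at t)"
      using DERIV_chain2[OF der s'] by (simp add: rv)
    have eq_x: "?r * (q ?x * (cos ?\<theta>)\<^sup>2) * cos ?\<theta> + ?r * (- sin ?\<theta> * ?v) = ?x * q ?x - ?r * sin ?\<theta>"
      using sin_cos_squared_add[of ?\<theta>] unfolding speed_def by algebra
    have eq_y: "?r * (q ?x * (cos ?\<theta>)\<^sup>2) * sin ?\<theta> + ?r * (cos ?\<theta> * ?v) = ?x"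
      unfolding speed_def by (simp add: algebra_simps power2_eq_square)
    have "((\<lambda>t. exp (\<rho> (s t)) * cos (s t)) has_real_derivative ?x * q ?x - ?r * sin ?\<theta>) (at t)"
      by (rule derivative_eq_intros rad s' refl)+ (use eq_x in \<open>simp add: algebra_simps\<close>)
    moreover have "((\<lambda>t. exp (\<rho> (s t)) * sin (s t)) has_real_derivative ?x) (at t)"
      by (rule derivative_eq_intros rad s' refl)+ (use eq_y in \<open>simp add: algebra_simps\<close>)
    ultimately show "(\<gamma> has_vector_derivative lienard_field (\<lambda>x. x * q x) (\<gamma> t)) (at t)"
      unfolding \<gamma>_def polar_def lienard_field_def prod.case
      by (intro has_vector_derivative_Pair) (simp_all add: has_real_derivative_iff_has_vector_derivative)
  qed
  moreover have "\<gamma> (t + T) = \<gamma> t" for t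
    by (simp add: \<gamma>_def polar_def s_per per)
  moreover have "\<not> \<gamma> constant_on UNIV"
  proof
    assume "\<gamma> constant_on UNIV"
    then have "\<gamma> (time 0) = \<gamma> (time pi)" unfolding constant_on_def by (metis UNIV_I)
    then have "exp (\<rho> 0) = - exp (\<rho> pi)" by (simp add: \<gamma>_def polar_def s)
    then show False using exp_gt_zero[of "\<rho> 0"] exp_gt_zero[of "\<rho> pi"] by linarith
  qed
  moreover have "range (polar \<rho>) = range \<gamma>"
  proof -
    have "polar \<rho> \<theta> = \<gamma> (time \<theta>)" for \<theta> by (simp add: \<gamma>_def s)
    then have "range (polar \<rho>) \<subseteq> range \<gamma>" by (metis image_subsetI rangeI)
    then show ?thesis by (auto simp: \<gamma>_def)
  qed
  ultimately show ?thesis using \<open>0 < T\<close> unfolding periodic_orbit_def by blast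
qed

text \<open>
  Conversely, the angle along a solution that avoids the origin is recovered by integrating the
  angular speed; \<open>e (x cos \<theta> + y sin \<theta>)\<close> and \<open>e (y cos \<theta> - x sin \<theta>)\<close> with
  \<open>e = 1 / \<bar>(x, y)\<bar>\<close> are then constants of motion.
\<close>

lemma periodic_orbit_is_polar:
  assumes orbit: "periodic_orbit (lienard_field (\<lambda>x. x * q x)) C" and "0 \<notin> C"
  obtains \<rho> and k :: nat where "0 < k"
    "\<And>\<theta>. (\<rho> has_real_derivative rhs (\<rho> \<theta>) \<theta>) (at \<theta>)"
    "\<And>\<theta>. \<rho> (\<theta> + of_nat k * (2 * pi)) = \<rho> \<theta>"
    "C = range (polar \<rho>)"
proof -
  obtain \<gamma> T where \<gamma>: "\<And>t. (\<gamma> has_vector_derivative lienard_field (\<lambda>x. x * q x) (\<gamma> t)) (at t)"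
    and T: "0 < T" "\<And>t. \<gamma> (t + T) = \<gamma> t" and C: "C = range \<gamma>"
    using orbit unfolding periodic_orbit_def ode_solution_def by blast
  define x y where "x t = fst (\<gamma> t)" and "y t = snd (\<gamma> t)" for t
  have x': "(x has_real_derivative x t * q (x t) - y t) (at t)" for t
    using bounded_linear.has_vector_derivative[OF bounded_linear_fst \<gamma>[of t]]
    by (simp add: x_def[abs_def] y_def lienard_field_def has_real_derivative_iff_has_vector_derivative
        split_beta)
  have y': "(y has_real_derivative x t) (at t)" for t
    using bounded_linear.has_vector_derivative[OF bounded_linear_snd \<gamma>[of t]]
    by (simp add: x_def y_def[abs_def] lienard_field_def has_real_derivative_iff_has_vector_derivative
        split_beta)
  define w where "w t = (x t)\<^sup>2 + (y t)\<^sup>2" for t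
  have w_pos: "0 < w t" for t
  proof -
    have "\<gamma> t \<noteq> 0" using \<open>0 \<notin> C\<close> C by (metis rangeI)
    then show ?thesis
      unfolding w_def x_def y_def by (metis prod_eq_iff fst_zero snd_zero sum_power2_gt_zero_iff)
  qed
  \<comment> \<open>\<open>L\<close> is the logarithm of the radius, \<alpha> its rate of change in
    time, and \<beta> the angular speed, all written in Cartesian coordinates so that no angle has
    to be known yet.\<close>
  define L where "L t = ln (w t) / 2" for t
  define \<alpha> where "\<alpha> t = q (x t) * (x t)\<^sup>2 / w t" for t
  define \<beta> where "\<beta> t = 1 - q (x t) * x t * y t / w t" for t
  have L': "(L has_real_derivative \<alpha> t) (at t)" for t
  proof -
    have "(w has_real_derivative 2 * (q (x t) * (x t)\<^sup>2)) (at t)"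
      unfolding w_def
      by (rule derivative_eq_intros x' y' refl)+ (simp add: algebra_simps power2_eq_square)
    from DERIV_cdivide[OF DERIV_chain2[OF DERIV_ln[OF w_pos] this], of 2]
    have "(L has_real_derivative inverse (w t) * (2 * (q (x t) * (x t)\<^sup>2)) / 2) (at t)"
      unfolding L_def .
    moreover have "inverse (w t) * (2 * (q (x t) * (x t)\<^sup>2)) / 2 = \<alpha> t"
      unfolding \<alpha>_def by (simp only: divide_inverse mult.commute mult.left_commute) simp
    ultimately show ?thesis by simp
  qed
  have xy_le: "\<bar>q (x t) * x t * y t / w t\<bar> \<le> \<tau>" for t
  proof -
    have "2 * (\<bar>x t\<bar> * \<bar>y t\<bar>) \<le> w t"
      using sum_squares_bound[of "\<bar>x t\<bar>" "\<bar>y t\<bar>"] unfolding w_def by simp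
    moreover have "0 \<le> \<bar>x t\<bar> * \<bar>y t\<bar>" by simp
    ultimately have "\<bar>x t * y t\<bar> \<le> w t" unfolding abs_mult by linarith
    then have "\<bar>q (x t)\<bar> * \<bar>x t * y t\<bar> \<le> \<tau> * w t"
      using w_pos[of t] q_bound tau_nonneg by (intro mult_mono) auto
    then show ?thesis using w_pos[of t] by (simp add: abs_mult field_simps)
  qed
  have \<beta>_ge: "1/2 \<le> \<beta> t" for t
    using xy_le[of t] tau unfolding \<beta>_def by linarith
  have x_cont: "continuous_on UNIV x" and y_cont: "continuous_on UNIV y"
    by (intro continuous_at_imp_continuous_on ballI DERIV_isCont[OF x'] DERIV_isCont[OF y'])+
  have \<beta>_cont: "continuous_on UNIV \<beta>"
  proof -
    have "continuous_on UNIV (\<lambda>t. q (x t))"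
      by (rule continuous_on_compose2[OF q_cont x_cont]) auto
    moreover have "w t \<noteq> 0" for t using w_pos[of t] by simp
    ultimately show ?thesis
      unfolding \<beta>_def w_def by (intro continuous_intros x_cont y_cont) (auto simp: w_def)
  qed
  have exp_L: "(exp (L t))\<^sup>2 = w t" for t
    using w_pos[of t] by (simp add: L_def flip: exp_double)
  have "(x 0 / exp (L 0))\<^sup>2 + (y 0 / exp (L 0))\<^sup>2 = 1"
    using w_pos[of 0] by (simp add: power_divide exp_L flip: add_divide_distrib) (simp add: w_def)
  then obtain \<theta>0 where "x 0 / exp (L 0) = cos \<theta>0" "y 0 / exp (L 0) = sin \<theta>0"
    using sincos_total_2pi by metis
  then have \<theta>0: "x 0 = exp (L 0) * cos \<theta>0" "y 0 = exp (L 0) * sin \<theta>0" by (auto simp: field_simps)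
  define \<Theta> where "\<Theta> t = \<theta>0 + prim \<beta> t" for t
  have \<Theta>': "(\<Theta> has_real_derivative \<beta> t) (at t)" for t
    unfolding \<Theta>_def by (auto intro!: derivative_eq_intros DERIV_prim \<beta>_cont)
  define p where "p t = exp (- L t) * (x t * cos (\<Theta> t) + y t * sin (\<Theta> t))" for t
  define r where "r t = exp (- L t) * (y t * cos (\<Theta> t) - x t * sin (\<Theta> t))" for t
  have \<alpha>\<beta>: "\<alpha> t * w t = q (x t) * (x t)\<^sup>2" "\<beta> t * w t = w t - q (x t) * x t * y t" for t
    using w_pos[of t] by (simp_all add: \<alpha>_def \<beta>_def field_simps)
  have p': "(p has_real_derivative 0) (at t)" for t
  proof -
    let ?c = "cos (\<Theta> t)" and ?s = "sin (\<Theta> t)"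
    let ?E = "- \<alpha> t * (x t * ?c + y t * ?s) + (x t * q (x t) - y t) * ?c + x t * ?s
      + \<beta> t * (y t * ?c - x t * ?s)"
    have "w t * ?E = - (\<alpha> t * w t) * (x t * ?c + y t * ?s) + w t * ((x t * q (x t) - y t) * ?c + x t * ?s)
      + (\<beta> t * w t) * (y t * ?c - x t * ?s)" by (simp add: algebra_simps)
    also have "\<dots> = 0" unfolding \<alpha>\<beta> by (simp add: w_def algebra_simps power2_eq_square)
    finally have "?E = 0" using w_pos[of t] by simp
    moreover have "(p has_real_derivative exp (- L t) * ?E) (at t)"
      unfolding p_def by (rule derivative_eq_intros x' y' L' \<Theta>' refl)+ (simp add: algebra_simps)
    ultimately show ?thesis by simp
  qed
  have r': "(r has_real_derivative 0) (at t)" for t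
  proof -
    let ?c = "cos (\<Theta> t)" and ?s = "sin (\<Theta> t)"
    let ?E = "- \<alpha> t * (y t * ?c - x t * ?s) - (x t * q (x t) - y t) * ?s + x t * ?c
      - \<beta> t * (x t * ?c + y t * ?s)"
    have "w t * ?E = - (\<alpha> t * w t) * (y t * ?c - x t * ?s) + w t * (- (x t * q (x t) - y t) * ?s + x t * ?c)
      - (\<beta> t * w t) * (x t * ?c + y t * ?s)" by (simp add: algebra_simps)
    also have "\<dots> = 0" unfolding \<alpha>\<beta> by (simp add: w_def algebra_simps power2_eq_square)
    finally have "?E = 0" using w_pos[of t] by simp
    moreover have "(r has_real_derivative exp (- L t) * ?E) (at t)"
      unfolding r_def by (rule derivative_eq_intros x' y' L' \<Theta>' refl)+ (simp add: algebra_simps)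
    ultimately show ?thesis by simp
  qed
  have \<Theta>_0: "\<Theta> 0 = \<theta>0" by (simp add: \<Theta>_def prim_0[OF \<beta>_cont])
  have p1: "p t = 1" for t
  proof -
    have "p t = p 0" using p' by (intro DERIV_isconst_all) auto
    also have "\<dots> = (exp (- L 0) * exp (L 0)) * ((cos \<theta>0)\<^sup>2 + (sin \<theta>0)\<^sup>2)"
      unfolding p_def \<Theta>_0 \<theta>0 by (simp only: algebra_simps power2_eq_square)
    also have "\<dots> = 1" by (simp flip: exp_add)
    finally show ?thesis .
  qed
  have r0: "r t = 0" for t
  proof -
    have "r t = r 0" using r' by (intro DERIV_isconst_all) auto
    also have "\<dots> = 0" unfolding r_def \<Theta>_0 \<theta>0 by simp
    finally show ?thesis .
  qed
  have polar_x: "x t = exp (L t) * cos (\<Theta> t)" and polar_y: "y t = exp (L t) * sin (\<Theta> t)" for t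
  proof -
    let ?c = "cos (\<Theta> t)" and ?s = "sin (\<Theta> t)"
    have 1: "x t * ?c + y t * ?s = exp (L t)"
      using p1[of t] by (simp add: p_def exp_minus field_simps)
    have 2: "y t * ?c - x t * ?s = 0"
      using r0[of t] by (simp add: r_def)
    have cs: "?c * ?c + ?s * ?s = 1" using sin_cos_squared_add3 by (simp add: add.commute)
    show "x t = exp (L t) * ?c" "y t = exp (L t) * ?s" using rotation_solve[OF 1 2 cs] by auto
  qed
  obtain s where s: "\<And>t. s (\<Theta> t) = t" "\<And>\<theta>. \<Theta> (s \<theta>) = \<theta>"
    and s': "\<And>\<theta>. (s has_real_derivative 1 / \<beta> (s \<theta>)) (at \<theta>)"
    using inverse_of_increasing[OF \<Theta>' \<beta>_ge] by blast
  define \<rho> where "\<rho> \<theta> = L (s \<theta>)" for \<theta>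
  have x_s: "x (s \<theta>) = exp (\<rho> \<theta>) * cos \<theta>" and y_s: "y (s \<theta>) = exp (\<rho> \<theta>) * sin \<theta>" for \<theta>
    using polar_x[of "s \<theta>"] polar_y[of "s \<theta>"] by (simp_all add: s \<rho>_def)
  have w_s: "w (s \<theta>) = (exp (\<rho> \<theta>))\<^sup>2" for \<theta> by (simp add: exp_L \<rho>_def)
  have "(\<rho> has_real_derivative rhs (\<rho> \<theta>) \<theta>) (at \<theta>)" for \<theta>
  proof -
    have "(\<rho> has_real_derivative \<alpha> (s \<theta>) * (1 / \<beta> (s \<theta>))) (at \<theta>)"
      unfolding \<rho>_def by (rule DERIV_chain2[OF L' s'])
    moreover have "\<alpha> (s \<theta>) = q (exp (\<rho> \<theta>) * cos \<theta>) * (cos \<theta>)\<^sup>2"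
      unfolding \<alpha>_def w_s x_s by (simp add: power_mult_distrib)
    moreover have "\<beta> (s \<theta>) = speed (\<rho> \<theta>) \<theta>"
      unfolding \<beta>_def w_s x_s y_s speed_def by (simp add: power2_eq_square)
    ultimately show ?thesis by (simp add: rhs_def)
  qed
  moreover have polar_eq: "polar \<rho> (\<Theta> t) = \<gamma> t" for t
    using polar_x[of t] polar_y[of t] by (simp add: polar_def \<rho>_def s x_def y_def prod_eq_iff)
  have "C = range (polar \<rho>)"
  proof -
    have "polar \<rho> \<theta> = \<gamma> (s \<theta>)" for \<theta> using polar_eq[of "s \<theta>"] by (simp add: s)
    then have "range (polar \<rho>) \<subseteq> range \<gamma>" by (metis image_subsetI rangeI)
    moreover have "range \<gamma> \<subseteq> range (polar \<rho>)" using polar_eq by (metis image_subsetI rangeI)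
    ultimately show ?thesis by (simp add: C)
  qed
  moreover have xy_T: "x (t + T) = x t" "y (t + T) = y t" for t by (simp_all add: x_def y_def T)
  have L_T: "L (t + T) = L t" for t by (simp add: L_def w_def xy_T)
  have \<beta>_T: "\<beta> (t + T) = \<beta> t" for t by (simp add: \<beta>_def w_def xy_T)
  have \<Theta>_T: "\<Theta> (t + T) = \<Theta> t + (\<Theta> T - \<Theta> 0)" for t
    by (rule antiderivative_periodic_shift[OF \<Theta>' \<beta>_T])
  \<comment> \<open>The position recurs after time \<open>T\<close>, so the angle has advanced by
    \<open>j\<close> full turns. Positive angular speed gives j > 0, but nothing so far excludes j >
    1; hence the number \<open>k\<close> in the conclusion.\<close>
  have "cos (\<Theta> T) = cos (\<Theta> 0) \<and> sin (\<Theta> T) = sin (\<Theta> 0)"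
    using xy_T[of 0] L_T[of 0] polar_x[of T] polar_x[of 0] polar_y[of T] polar_y[of 0] by simp
  then obtain j :: int where j: "\<Theta> T = \<Theta> 0 + 2 * pi * of_int j"
    using sin_cos_eq_iff[of "\<Theta> T" "\<Theta> 0"] by (auto simp: mult.commute)
  have "1/2 * (T - 0) \<le> \<Theta> T - \<Theta> 0"
    using T by (intro DERIV_ge_imp_diff_ge[OF _ \<Theta>' \<beta>_ge]) auto
  then have "T \<le> 2 * (2 * pi * of_int j)" unfolding j by simp
  then have "0 < 2 * (2 * pi * of_int j)" using T(1) by (rule order_less_le_trans[rotated])
  then have "0 < j" by (simp add: zero_less_mult_iff)
  have "\<rho> (\<theta> + of_nat (nat j) * (2 * pi)) = \<rho> \<theta>" for \<theta>
  proof -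
    have "\<theta> + of_nat (nat j) * (2 * pi) = \<Theta> (s \<theta> + T)"
      using \<Theta>_T[of "s \<theta>"] j \<open>0 < j\<close> by (simp add: s mult.commute)
    then show ?thesis by (simp add: \<rho>_def s L_T)
  qed
  moreover have "0 < nat j" using \<open>0 < j\<close> by simp
  ultimately show ?thesis using that by blast
qed

end

subsection \<open>Comparison of two solutions\<close>

context small_ratio
begin

text \<open>The reciprocal radii satisfy a linear differential inequality with the small constant 4
  \<tau>, however far apart the two solutions are. Over one turn their difference thus stays between
  half and three halves of its initial value.\<close>

lemma inv_radius_close:
  assumes f: "\<And>\<theta>. (f has_real_derivative rhs (f \<theta>) \<theta>) (at \<theta>)"
    and g: "\<And>\<theta>. (g has_real_derivative rhs (g \<theta>) \<theta>) (at \<theta>)"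
    and \<theta>: "a \<le> \<theta>" "\<theta> \<le> a + 2 * pi"
  shows "\<bar>(exp (- f \<theta>) - exp (- g \<theta>)) - (exp (- f a) - exp (- g a))\<bar>
      \<le> \<bar>exp (- f a) - exp (- g a)\<bar> / 2"
proof -
  have bound: "exp (- v) * \<bar>rhs u t - rhs v t\<bar> \<le> 2 * \<tau> * \<bar>exp (- u) - exp (- v)\<bar>" for u v t
  proof -
    \<comment> \<open>Multiplying 1 - exp (u - v) by exp (-u) gives exactly the difference of the
      reciprocal radii when u \<le> v; the other case is symmetric and has the weight exp (-v)
      already.\<close>
    have "exp (- v) * \<bar>q (exp u * cos t) - q (exp v * cos t)\<bar> \<le> \<tau> * \<bar>exp (- u) - exp (- v)\<bar>"
    proof (cases "u \<le> v")
      case True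
      then have "\<bar>q (exp u * cos t) - q (exp v * cos t)\<bar> \<le> \<tau> * (1 - exp (u - v))"
        by (rule q_ratio)
      then have "exp (- v) * \<bar>q (exp u * cos t) - q (exp v * cos t)\<bar> \<le>
          exp (- u) * (\<tau> * (1 - exp (u - v)))"
        using True by (intro mult_mono) auto
      also have "\<dots> = \<tau> * (exp (- u) - exp (- v))"
        by (simp add: algebra_simps flip: exp_add)
      also have "\<dots> = \<tau> * \<bar>exp (- u) - exp (- v)\<bar>" using True by simp
      finally show ?thesis .
    next
      case False
      then have "\<bar>q (exp u * cos t) - q (exp v * cos t)\<bar> \<le> \<tau> * (1 - exp (v - u))"
        using q_ratio[of v u "cos t"] by (simp add: abs_minus_commute)
      then have "exp (- v) * \<bar>q (exp u * cos t) - q (exp v * cos t)\<bar> \<le>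
          exp (- v) * (\<tau> * (1 - exp (v - u)))"
        by (intro mult_left_mono) auto
      also have "\<dots> = \<tau> * (exp (- v) - exp (- u))"
        by (simp add: algebra_simps flip: exp_add)
      also have "\<dots> = \<tau> * \<bar>exp (- u) - exp (- v)\<bar>" using False by simp
      finally show ?thesis .
    qed
    then have "2 * (exp (- v) * \<bar>q (exp u * cos t) - q (exp v * cos t)\<bar>) \<le> 2 * \<tau> * \<bar>exp (- u) - exp (- v)\<bar>"
      by (simp only: mult.assoc mult_left_mono)
    moreover have "exp (- v) * \<bar>rhs u t - rhs v t\<bar> \<le>
        exp (- v) * (2 * \<bar>q (exp u * cos t) - q (exp v * cos t)\<bar>)"
      by (intro mult_left_mono rhs_diff_le) auto
    ultimately show ?thesis by (simp only: mult.left_commute)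
  qed
  show ?thesis
  proof (rule linear_growth_bound[where f = "\<lambda>\<theta>. exp (- f \<theta>) - exp (- g \<theta>)" and a = a and x = \<theta>
        and b = "a + 2 * pi" and L = "4 * \<tau>"])
    fix t
    show "((\<lambda>\<theta>. exp (- f \<theta>) - exp (- g \<theta>)) has_real_derivative
        exp (- g t) * rhs (g t) t - exp (- f t) * rhs (f t) t) (at t)"
      by (rule derivative_eq_intros f g refl)+ simp
    have "exp (- g t) * rhs (g t) t - exp (- f t) * rhs (f t) t =
      - (exp (- g t) * (rhs (f t) t - rhs (g t) t)) - (exp (- f t) - exp (- g t)) * rhs (f t) t"
      by (simp add: algebra_simps)
    then have "\<bar>exp (- g t) * rhs (g t) t - exp (- f t) * rhs (f t) t\<bar> \<le>
        exp (- g t) * \<bar>rhs (f t) t - rhs (g t) t\<bar> + \<bar>exp (- f t) - exp (- g t)\<bar> * \<bar>rhs (f t) t\<bar>"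
      using abs_triangle_ineq4[of "- (exp (- g t) * (rhs (f t) t - rhs (g t) t))"
          "(exp (- f t) - exp (- g t)) * rhs (f t) t"] by (simp add: abs_mult)
    moreover have "\<bar>exp (- f t) - exp (- g t)\<bar> * \<bar>rhs (f t) t\<bar> \<le> \<bar>exp (- f t) - exp (- g t)\<bar> * (2 * \<tau>)"
      by (intro mult_left_mono rhs_bound) auto
    ultimately show "\<bar>exp (- g t) * rhs (g t) t - exp (- f t) * rhs (f t) t\<bar>
        \<le> 4 * \<tau> * \<bar>exp (- f t) - exp (- g t)\<bar>"
      using bound[of "g t" "f t" t] by (simp add: algebra_simps)
  next
    have "4 * \<tau> * (2 * pi) \<le> 4 * (1/5000) * (2 * 4)"
      using tau tau_nonneg pi_less_4 by (intro mult_mono) auto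
    moreover have "4 * \<tau> * (a + 2 * pi - a) = 4 * \<tau> * (2 * pi)" by simp
    ultimately show "4 * \<tau> * (a + 2 * pi - a) \<le> 1/3" by linarith
  qed (use tau_nonneg \<theta> in auto)
qed

text \<open>A gap that changes by at most half of its initial value can neither change sign nor
  arise from zero. This gives order preservation and forward uniqueness for one turn.\<close>

lemma solution_order:
  assumes f: "\<And>\<theta>. (f has_real_derivative rhs (f \<theta>) \<theta>) (at \<theta>)"
    and g: "\<And>\<theta>. (g has_real_derivative rhs (g \<theta>) \<theta>) (at \<theta>)"
    and \<theta>: "a \<le> \<theta>" "\<theta> \<le> a + 2 * pi"
  shows "f a < g a \<Longrightarrow> f \<theta> < g \<theta>" "f a = g a \<Longrightarrow> f \<theta> = g \<theta>"
proof -
  note close = inv_radius_close[OF assms]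
  show "f \<theta> < g \<theta>" if "f a < g a"
  proof -
    have "exp (- g a) < exp (- f a)" using that by simp
    with close have "exp (- g \<theta>) < exp (- f \<theta>)" by argo
    then show ?thesis by simp
  qed
  show "f \<theta> = g \<theta>" if "f a = g a"
    using close that by simp
qed

lemma DERIV_solution_shift:
  assumes "\<And>\<theta>. (f has_real_derivative rhs (f \<theta>) \<theta>) (at \<theta>)"
  shows "((\<lambda>\<theta>. f (\<theta> + of_nat j * (2 * pi))) has_real_derivative
    rhs (f (\<theta> + of_nat j * (2 * pi))) \<theta>) (at \<theta>)"
proof -
  interpret periodic_fun_simple "rhs \<rho>" "2 * pi" for \<rho>
    by standard (rule rhs_periodic)
  show ?thesis
    using assms[of "\<theta> + of_nat j * (2 * pi)"] DERIV_shift[of f _ \<theta> "of_nat j * (2 * pi)"]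
    by (simp add: plus_of_nat)
qed

text \<open>Forward uniqueness is propagated turn by turn from \<open>a\<close>; the common period
  then carries the equality to angles before \<open>a\<close>.\<close>

lemma solution_eqI:
  assumes f: "\<And>\<theta>. (f has_real_derivative rhs (f \<theta>) \<theta>) (at \<theta>)"
    and g: "\<And>\<theta>. (g has_real_derivative rhs (g \<theta>) \<theta>) (at \<theta>)"
    and per: "\<And>\<theta>. f (\<theta> + of_nat k * (2 * pi)) = f \<theta>" "\<And>\<theta>. g (\<theta> + of_nat k * (2 * pi)) = g \<theta>"
    and "0 < k" and init: "f a = g a"
  shows "f = g"
proof
  fix \<theta>
  have start: "f (a + of_nat j * (2 * pi)) = g (a + of_nat j * (2 * pi))" for j
  proof (induction j)
    case (Suc j)
    from solution_order(2)[OF DERIV_solution_shift[OF f] DERIV_solution_shift[OF g], of a "a + 2 * pi" j j]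
    show ?case using Suc by (simp add: algebra_simps)
  qed (simp add: init)
  let ?D = "\<lambda>t. f (t + a) - g (t + a)"
  obtain t where t: "0 \<le> t" "t < of_nat k * (2 * pi)" "?D t = ?D (\<theta> - a)"
    using per \<open>0 < k\<close>
    by (rule_tac periodic_reduce[of ?D "of_nat k * (2 * pi)" "\<theta> - a"])
       (auto simp: add.assoc add.commute[of _ a] simp flip: add.assoc)
  let ?j = "nat \<lfloor>t / (2 * pi)\<rfloor>"
  have j: "of_nat ?j * (2 * pi) \<le> t" "t \<le> of_nat ?j * (2 * pi) + 2 * pi"
    using t(1) floor_divide_lower[of "2 * pi" t] floor_divide_upper[of "2 * pi" t]
    by (auto simp: algebra_simps)
  from solution_order(2)[OF f g, of "a + of_nat ?j * (2 * pi)" "t + a"] start[of ?j] j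
  have "f (t + a) = g (t + a)" by simp
  then show "f \<theta> = g \<theta>" using t(3) by simp
qed

end

subsection \<open>One-sided derivatives and fold points\<close>

text \<open>At the corner x = s the right derivative is 1, hence the non-strict comparison; its left
  counterpart has the strict one. This difference detects the folds.\<close>

lemma abs_diff_has_right_derivative:
  "((\<lambda>y. \<bar>y - s\<bar>) has_real_derivative (if s \<le> x then 1 else -1)) (at_right x)"
proof -
  have "eventually (\<lambda>y. (\<bar>y - s\<bar> - \<bar>x - s\<bar>) / (y - x) = (if s \<le> x then 1 else -1)) (at_right x)"
  proof (cases "s \<le> x")
    case True
    then show ?thesis by (auto simp: eventually_at_filter intro!: always_eventually)
  next
    case False
    then have "eventually (\<lambda>y. y \<in> {x<..<s}) (at_right x)"
      by (intro eventually_at_right_real) auto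
    then show ?thesis by (rule eventually_mono) (use False in \<open>auto simp: field_simps\<close>)
  qed
  then show ?thesis unfolding has_field_derivative_iff by (rule tendsto_eventually)
qed

lemma abs_diff_has_left_derivative:
  "((\<lambda>y. \<bar>y - s\<bar>) has_real_derivative (if s < x then 1 else -1)) (at_left x)"
proof -
  have "eventually (\<lambda>y. (\<bar>y - s\<bar> - \<bar>x - s\<bar>) / (y - x) = (if s < x then 1 else -1)) (at_left x)"
  proof (cases "s < x")
    case False
    then show ?thesis by (auto simp: eventually_at_filter divide_simps intro!: always_eventually)
  next
    case True
    then have "eventually (\<lambda>y. y \<in> {s<..<x}) (at_left x)"
      by (intro eventually_at_left_real) auto
    then show ?thesis by (rule eventually_mono) (use True in \<open>auto simp: field_simps\<close>)
  qed
  then show ?thesis unfolding has_field_derivative_iff by (rule tendsto_eventually)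
qed

text \<open>The one-sided derivatives \<open>R\<close> and \<open>L\<close> differ only in the terms
  whose knot is \<open>x\<close>. Injectivity of \<xi> leaves at most one such term, with the
  nonzero jump 2 \<alpha> i, so no cancellation can hide a fold.\<close>

lemma fold_points_abs_sum:
  fixes \<alpha> \<xi> :: "'i \<Rightarrow> real"
  assumes "finite A" and inj: "inj_on \<xi> A" and nz: "\<And>i. i \<in> A \<Longrightarrow> \<alpha> i \<noteq> 0"
    and F: "\<And>x. F x = a * x + b + (\<Sum>i\<in>A. \<alpha> i * \<bar>x - \<xi> i\<bar>)"
  shows "fold_points F = (\<lambda>i. (\<xi> i, F (\<xi> i))) ` A"
proof -
  define R where "R x = a + (\<Sum>i\<in>A. \<alpha> i * (if \<xi> i \<le> x then 1 else -1))" for x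
  define L where "L x = a + (\<Sum>i\<in>A. \<alpha> i * (if \<xi> i < x then 1 else -1))" for x
  have F_eq: "F = (\<lambda>x. a * x + b + (\<Sum>i\<in>A. \<alpha> i * \<bar>x - \<xi> i\<bar>))" using F by auto
  have right: "(F has_real_derivative R x) (at_right x)" for x
    unfolding F_eq R_def
    by (rule derivative_eq_intros DERIV_cmult abs_diff_has_right_derivative refl | assumption)+ simp
  have left: "(F has_real_derivative L x) (at_left x)" for x
    unfolding F_eq L_def
    by (rule derivative_eq_intros DERIV_cmult abs_diff_has_left_derivative refl | assumption)+ simp
  have cont: "isCont F x" for x
    unfolding F_eq by (intro continuous_intros)
  have jump: "R x - L x = (\<Sum>i\<in>{i \<in> A. \<xi> i = x}. 2 * \<alpha> i)" for x
  proof -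
    have "R x - L x = (\<Sum>i\<in>A. if \<xi> i = x then 2 * \<alpha> i else 0)"
      unfolding R_def L_def by (simp add: algebra_simps flip: sum_subtractf) (rule sum.cong, auto)
    also have "\<dots> = (\<Sum>i\<in>{i \<in> A. \<xi> i = x}. 2 * \<alpha> i)" using \<open>finite A\<close> by (simp add: sum.inter_filter)
    finally show ?thesis .
  qed
  have neq: "L x \<noteq> R x \<longleftrightarrow> x \<in> \<xi> ` A" for x
  proof
    assume "x \<in> \<xi> ` A"
    then obtain i where i: "i \<in> A" "x = \<xi> i" by auto
    then have "{i \<in> A. \<xi> i = x} = {i}" using inj by (auto dest: inj_onD)
    then show "L x \<noteq> R x" using jump[of x] nz[OF i(1)] by auto
  next
    assume "L x \<noteq> R x"
    then have "{i \<in> A. \<xi> i = x} \<noteq> {}" using jump[of x] by (metis eq_iff_diff_eq_0 sum.empty)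
    then show "x \<in> \<xi> ` A" by auto
  qed
  have "(\<exists>l r. (F has_real_derivative l) (at_left x) \<and> (F has_real_derivative r) (at_right x) \<and> l \<noteq> r)
      \<longleftrightarrow> x \<in> \<xi> ` A" for x
  proof -
    have "l = L x" if "(F has_real_derivative l) (at_left x)" for l
      using has_field_derivative_unique[OF that left] by simp
    moreover have "r = R x" if "(F has_real_derivative r) (at_right x)" for r
      using has_field_derivative_unique[OF that right] by simp
    ultimately show ?thesis using left right neq by blast
  qed
  then show ?thesis unfolding fold_points_def using cont by auto
qed

lemma jump_points_continuous:
  assumes "continuous_on UNIV F"
  shows "jump_points F = {}"
proof -
  have "isCont F x" for x using assms by (simp add: continuous_on_eq_continuous_at)
  then have "(F \<longlongrightarrow> F x) (at_left x)" "(F \<longlongrightarrow> F x) (at_right x)" for x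
    by (simp_all add: isCont_def tendsto_within_subset filterlim_at_split)
  then have "l = r" if "(F \<longlongrightarrow> l) (at_left x)" "(F \<longlongrightarrow> r) (at_right x)" for l r x
    using tendsto_unique[OF trivial_limit_at_left_real that(1)]
      tendsto_unique[OF trivial_limit_at_right_real that(2)] by metis
  then show ?thesis unfolding jump_points_def by blast
qed

subsection \<open>The truncated hyperbola\<close>

definition hinge :: "real \<Rightarrow> real \<Rightarrow> real" where
  "hinge s x = (if x \<le> s then 0 else 1 - s / x)"

lemma hinge_eq_0: "x \<le> s \<Longrightarrow> hinge s x = 0"
  by (simp add: hinge_def)

lemma mult_hinge:
  assumes "0 < s"
  shows "x * hinge s x = (x - s + \<bar>x - s\<bar>) / 2"
  using assms by (auto simp: hinge_def field_simps)

lemma hinge_bounds: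
  assumes "0 < s"
  shows "0 \<le> hinge s x" "hinge s x \<le> 1"
  using assms by (auto simp: hinge_def field_simps)

lemma hinge_ge:
  assumes "0 < s" "0 < x"
  shows "1 - s / x \<le> hinge s x"
  using assms by (auto simp: hinge_def field_simps)

lemma hinge_mono:
  assumes "0 < s" "x \<le> y"
  shows "hinge s x \<le> hinge s y"
  using assms by (auto simp: hinge_def divide_left_mono)

text \<open>The first bound is weighted with the knot, which makes hinges of much smaller knots
  negligible. The second does not involve the knot, so the locale constant \<tau> is independent of
  the scales.\<close>

lemma hinge_diff_le:
  assumes "0 < s" "0 < x" "x \<le> y"
  shows "hinge s y - hinge s x \<le> s * (1 / x - 1 / y)" "hinge s y - hinge s x \<le> 1 - x / y"
proof -
  have "hinge s y - hinge s x \<le> s * (1 / x - 1 / y) \<and> hinge s y - hinge s x \<le> 1 - x / y"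
  proof (cases "s < x")
    case True
    have "s / x - s / y = (s / x) * (1 - x / y)" using assms by (simp add: field_simps)
    also have "\<dots> \<le> 1 * (1 - x / y)" using assms True by (intro mult_right_mono) auto
    finally show ?thesis using assms True by (simp add: hinge_def right_diff_distrib)
  next
    case False
    then have x: "hinge s x = 0" "1 \<le> s / x" using assms by (simp_all add: hinge_def)
    have "x / y \<le> s / y" using False assms by (simp add: divide_right_mono)
    moreover have "s / y \<le> s / x" using assms by (simp add: divide_left_mono)
    moreover have "x / y \<le> 1" using assms by simp
    ultimately show ?thesis using x by (auto simp: hinge_def right_diff_distrib)
  qed
  then show "hinge s y - hinge s x \<le> s * (1 / x - 1 / y)" "hinge s y - hinge s x \<le> 1 - x / y" by auto
qed

lemma continuous_on_hinge [continuous_intros]: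
  assumes "0 < s"
  shows "continuous_on UNIV (hinge s)"
proof -
  have "hinge s x = max 0 (1 - s / max s x)" for x
    using assms by (auto simp: hinge_def max_def)
  moreover have "continuous_on UNIV (\<lambda>x. max 0 (1 - s / max s x))"
    using assms by (intro continuous_intros) auto
  ultimately show ?thesis by (simp add: continuous_on_eq)
qed

section \<open>Trigonometric values and the alternating sum\<close>

lemma cos_half_integer_pi: "cos (- (pi / 2)) = 0" "cos (3 * pi / 2) = 0"
proof -
  show "cos (3 * pi / 2) = 0" using cos_periodic_pi[of "pi / 2"] by (simp add: field_simps)
qed simp

lemma cos_nonpos: "pi / 2 \<le> x \<Longrightarrow> x \<le> 3 * pi / 2 \<Longrightarrow> cos x \<le> 0"
  using cos_ge_zero[of "x - pi"] by simp

lemma cos_ge_4_5: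
  assumes "- (pi / 6) \<le> x" "x \<le> pi / 6"
  shows "4/5 \<le> cos x"
proof -
  have "cos (pi / 6) \<le> cos \<bar>x\<bar>" using assms by (intro cos_monotone_0_pi_le) auto
  moreover have "8/5 \<le> sqrt 3" by (rule real_le_rsqrt) (simp add: power2_eq_square)
  ultimately show ?thesis by (simp add: cos_30)
qed

lemma sum_minus_one_powers: "(\<Sum>i = 1..<Suc k. (-1) ^ i) = (if even k then 0 else -1 :: real)"
  by (induction k) auto

subsection \<open>The nested knots\<close>

locale nested_knots =
  fixes n :: nat
begin

definition N :: real where "N = 1 + 4 * real n"
definition \<epsilon> :: real where "\<epsilon> = 1 / (10000 * N\<^sup>2)"
text \<open>At most n knots lie below a given one, each smaller by a factor \<open>base\<close> or
  more. The factor n + 1 keeps even their sum below a thousandth of that knot.\<close>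

definition base :: real where "base = 1000 * (real n + 1)"
definition \<xi> :: "nat \<Rightarrow> real" where "\<xi> i = base ^ i"
definition ratio :: "real \<Rightarrow> real" where
  "ratio x = 1 + 4 * (\<Sum>i = 1..n. (-1) ^ i * hinge (\<xi> i) x)"
definition F :: "real \<Rightarrow> real" where "F x = x * (\<epsilon> * ratio x)"

lemma N_ge: "1 \<le> N"
  by (simp add: N_def)

lemma eps_pos: "0 < \<epsilon>"
  using N_ge by (simp add: \<epsilon>_def)

lemma eps_N: "\<epsilon> * N \<le> 1/10000" "0 < \<epsilon> * N" "\<epsilon> * N * N = 1/10000"
proof -
  show "\<epsilon> * N * N = 1/10000" using N_ge by (simp add: \<epsilon>_def power2_eq_square)
  show "0 < \<epsilon> * N" using N_ge eps_pos by simp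
  then have "(\<epsilon> * N) * 1 \<le> (\<epsilon> * N) * N" using N_ge by (intro mult_left_mono) auto
  then show "\<epsilon> * N \<le> 1/10000" using \<open>\<epsilon> * N * N = 1/10000\<close> by simp
qed

lemma base_ge: "1000 \<le> base" "1000 * real n \<le> base"
  by (simp_all add: base_def)

lemma xi_pos: "0 < \<xi> i"
  using base_ge by (simp add: \<xi>_def)

lemma xi_Suc: "\<xi> (Suc i) = base * \<xi> i"
  by (simp add: \<xi>_def)

lemma xi_mono: "i \<le> j \<Longrightarrow> \<xi> i \<le> \<xi> j"
  using base_ge by (simp add: \<xi>_def power_increasing)

lemma xi_Suc_ge: "1000 * \<xi> i \<le> \<xi> (Suc i)"
  using base_ge xi_pos[of i] by (simp add: xi_Suc)

lemma xi_strict_mono: "i < j \<Longrightarrow> \<xi> i < \<xi> j"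
  using xi_Suc_ge[of i] xi_mono[of "Suc i" j] xi_pos[of i] by simp

lemma sum_lower_knots:
  assumes "k \<le> Suc n"
  shows "(\<Sum>i = 1..<k. \<xi> i) \<le> \<xi> k / 1000"
proof -
  have "(\<Sum>i = 1..<k. \<xi> i) \<le> (\<Sum>i = 1..<k. \<xi> k / base)"
  proof (rule sum_mono)
    fix i assume "i \<in> {1..<k}"
    then have "\<xi> (Suc i) \<le> \<xi> k" by (intro xi_mono) auto
    then show "\<xi> i \<le> \<xi> k / base" using base_ge by (simp add: xi_Suc field_simps)
  qed
  also have "\<dots> = real (k - 1) * (\<xi> k / base)" by simp
  also have "\<dots> \<le> real n * (\<xi> k / base)"
    using assms xi_pos[of k] base_ge by (intro mult_right_mono) auto
  also have "\<dots> = (real n / base) * \<xi> k" by simp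
  also have "\<dots> \<le> (1/1000) * \<xi> k"
    using xi_pos[of k] base_ge by (intro mult_right_mono) (auto simp: field_simps)
  finally show ?thesis by simp
qed

lemma ratio_split:
  assumes "1 \<le> k" "k \<le> Suc n" "x \<le> \<xi> (Suc k)"
  shows "ratio x = 1 + 4 * (\<Sum>i = 1..<k. (-1) ^ i * hinge (\<xi> i) x)
    + (if k \<le> n then 4 * (-1) ^ k * hinge (\<xi> k) x else 0)"
proof -
  let ?h = "\<lambda>i. (-1) ^ i * hinge (\<xi> i) x"
  have vanish: "?h i = 0" if "k < i" for i
    using assms(3) xi_mono[of "Suc k" i] that by (simp add: hinge_eq_0)
  show ?thesis
  proof (cases "k \<le> n")
    case True
    have "(\<Sum>i = 1..n. ?h i) = (\<Sum>i = 1..k. ?h i)"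
      by (rule sum.mono_neutral_right) (use True vanish in auto)
    also have "\<dots> = (\<Sum>i = 1..<k. ?h i) + ?h k"
      using assms(1) by (simp add: sum.last_plus add.commute)
    finally show ?thesis using True by (simp add: ratio_def algebra_simps)
  next
    case False
    then have "{1..n} = {1..<k}" using assms by auto
    then show ?thesis using False by (simp add: ratio_def)
  qed
qed

lemma ratio_nonpos: "x \<le> 0 \<Longrightarrow> ratio x = 1"
  by (simp add: ratio_def hinge_eq_0 order_trans[OF _ order_less_imp_le[OF xi_pos]])

lemma ratio_bound: "\<bar>ratio x\<bar> \<le> N"
proof -
  have "\<bar>\<Sum>i = 1..n. (-1) ^ i * hinge (\<xi> i) x\<bar> \<le> (\<Sum>i = 1..n. 1)"
    by (rule order_trans[OF sum_abs sum_mono]) (use hinge_bounds[OF xi_pos] in \<open>auto simp: abs_mult\<close>)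
  then show ?thesis unfolding ratio_def N_def by simp
qed

lemma ratio_radial:
  assumes "a \<le> b"
  shows "\<bar>ratio (exp a * c) - ratio (exp b * c)\<bar> \<le> N * (1 - exp (a - b))"
proof (cases "c \<le> 0")
  case True
  then show ?thesis using assms N_ge by (simp add: ratio_nonpos mult_nonneg_nonpos)
next
  case False
  define x y where "x = exp a * c" and "y = exp b * c"
  have xy: "0 < x" "x \<le> y" using False assms by (auto simp: x_def y_def)
  have "x / y = exp (a - b)" using False by (simp add: x_def y_def exp_diff)
  then have d: "\<bar>(-1) ^ i * (hinge (\<xi> i) y - hinge (\<xi> i) x)\<bar> \<le> 1 - exp (a - b)" for i
    using hinge_diff_le(2)[OF xi_pos xy, of i] hinge_mono[OF xi_pos xy(2), of i] by (simp add: abs_mult)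
  have "ratio y - ratio x = 4 * (\<Sum>i = 1..n. (-1) ^ i * (hinge (\<xi> i) y - hinge (\<xi> i) x))"
    by (simp add: ratio_def right_diff_distrib sum_subtractf)
  moreover have "\<bar>\<Sum>i = 1..n. (-1) ^ i * (hinge (\<xi> i) y - hinge (\<xi> i) x)\<bar> \<le> (\<Sum>i = 1..n. 1 - exp (a - b))"
    by (rule order_trans[OF sum_abs sum_mono]) (rule d)
  ultimately have "\<bar>ratio y - ratio x\<bar> \<le> (4 * real n) * (1 - exp (a - b))" by simp
  also have "\<dots> \<le> N * (1 - exp (a - b))" using assms by (intro mult_right_mono) (auto simp: N_def)
  finally show ?thesis by (simp add: x_def y_def abs_minus_commute)
qed

end

sublocale nested_knots \<subseteq> small_ratio "\<lambda>x. \<epsilon> * ratio x" "\<epsilon> * N"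
proof
  fix a b c x :: real
  show "\<epsilon> * N \<le> 1/5000" using eps_N by simp
  show "\<bar>\<epsilon> * ratio x\<bar> \<le> \<epsilon> * N"
    using eps_pos ratio_bound[of x] by (simp add: abs_mult)
  show "\<bar>\<epsilon> * ratio (exp a * c) - \<epsilon> * ratio (exp b * c)\<bar> \<le> \<epsilon> * N * (1 - exp (a - b))" if "a \<le> b"
    using mult_left_mono[OF ratio_radial[OF that, of c], of \<epsilon>] eps_pos
    by (simp add: abs_mult mult.assoc flip: right_diff_distrib)
  show "continuous_on UNIV (\<lambda>x. \<epsilon> * ratio x)"
    unfolding ratio_def by (intro continuous_intros xi_pos)
qed

section \<open>Sign of the mean near a knot and existence of a periodic solution in each
  annulus\<close>

context nested_knots
begin

text \<open>
  Near the knot \<open>\<xi> k\<close> the ratio is still governed by the previous slope: on the right half plane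
  it differs from \<open>1\<close> (\<open>k\<close> odd) or \<open>-3\<close> (\<open>k\<close> even) by the contribution of the knot \<open>\<xi> k\<close> itself,
  which is at most \<open>4/3\<close>, and by a tail.
\<close>

lemma rhs_sign:
  assumes k: "1 \<le> k" "k \<le> Suc n"
    and r: "\<xi> k / 2 \<le> exp \<rho>" "exp \<rho> \<le> 3/2 * \<xi> k"
  shows "0 \<le> cos \<theta> \<Longrightarrow>
      \<epsilon> * ((if odd k then -1/3 else 5/3) * (cos \<theta>)\<^sup>2 - 1/100) \<le> (-1) ^ Suc k * rhs \<rho> \<theta>"
    and "cos \<theta> \<le> 0 \<Longrightarrow>
      \<epsilon> * ((if odd k then 1 else -1) * (cos \<theta>)\<^sup>2 - 1/100) \<le> (-1) ^ Suc k * rhs \<rho> \<theta>"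
proof -
  let ?c = "cos \<theta>" and ?s = "(-1) ^ Suc k :: real"
  define x where "x = exp \<rho> * ?c"
  \<comment> \<open>Replacing the angular speed by 1 costs at most 2 \<epsilon> N N = 1/5000, and
    1/125 + 1/5000 is below 1/100.\<close>
  have red: "\<epsilon> * (A * ?c\<^sup>2 - 1/100) \<le> ?s * rhs \<rho> \<theta>" if A: "A * ?c\<^sup>2 - 1/125 \<le> ?s * ratio x * ?c\<^sup>2" for A
  proof -
    let ?D = "speed \<rho> \<theta>"
    have D: "\<bar>1 - ?D\<bar> \<le> \<epsilon> * N" "1/2 \<le> ?D"
      using speed_bounds[of \<rho> \<theta>] eps_N by auto
    have "?s * ratio x * ?c\<^sup>2 / ?D - ?s * ratio x * ?c\<^sup>2 = (?s * ratio x * ?c\<^sup>2) * ((1 - ?D) / ?D)"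
      using D by (simp add: field_simps)
    moreover have "\<bar>(?s * ratio x * ?c\<^sup>2) * ((1 - ?D) / ?D)\<bar> \<le> (N * 1) * (2 * (\<epsilon> * N))"
    proof -
      have "\<bar>(1 - ?D) / ?D\<bar> \<le> 2 * (\<epsilon> * N)"
      proof -
        have "\<bar>1 - ?D\<bar> / ?D \<le> (\<epsilon> * N) / (1/2)" using D eps_N by (intro frac_le) auto
        then show ?thesis using D by simp
      qed
      moreover have "\<bar>?s * ratio x * ?c\<^sup>2\<bar> \<le> N * 1"
        unfolding abs_mult using ratio_bound[of x] N_ge by (intro mult_mono) (auto simp: abs_square_le_1)
      ultimately show ?thesis unfolding abs_mult[of "_ * _" "_ / _"] using N_ge by (intro mult_mono) auto
    qed
    moreover have "(N * 1) * (2 * (\<epsilon> * N)) = 1/5000" using eps_N(3) by (simp add: algebra_simps)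
    ultimately have "A * ?c\<^sup>2 - 1/100 \<le> ?s * ratio x * ?c\<^sup>2 / ?D" using A by linarith
    then have "\<epsilon> * (A * ?c\<^sup>2 - 1/100) \<le> \<epsilon> * (?s * ratio x * ?c\<^sup>2 / ?D)"
      using eps_pos by (intro mult_left_mono) auto
    also have "\<dots> = ?s * rhs \<rho> \<theta>" unfolding rhs_def x_def by (simp add: mult_ac)
    finally show ?thesis .
  qed
  show "\<epsilon> * ((if odd k then 1 else -1) * ?c\<^sup>2 - 1/100) \<le> ?s * rhs \<rho> \<theta>" if "?c \<le> 0"
  proof (rule red)
    have "x \<le> 0" using that by (simp add: x_def mult_nonneg_nonpos)
    then show "(if odd k then 1 else -1) * ?c\<^sup>2 - 1/125 \<le> ?s * ratio x * ?c\<^sup>2"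
      by (simp add: ratio_nonpos)
  qed
  show "\<epsilon> * ((if odd k then -1/3 else 5/3) * ?c\<^sup>2 - 1/100) \<le> ?s * rhs \<rho> \<theta>" if "0 \<le> ?c"
  proof (rule red)
    show "(if odd k then -1/3 else 5/3) * ?c\<^sup>2 - 1/125 \<le> ?s * ratio x * ?c\<^sup>2"
    proof (cases "?c = 0")
      case False
      with that have c: "0 < ?c" by simp
      have x_pos: "0 < x" using c by (simp add: x_def)
      have "x \<le> (3/2 * \<xi> k) * 1" unfolding x_def using r c xi_pos[of k] by (intro mult_mono) auto
      then have x_le: "x \<le> 3/2 * \<xi> k" by simp
      then have "x \<le> \<xi> (Suc k)" using xi_Suc_ge[of k] xi_pos[of k] by linarith
      note split = ratio_split[OF k this]
      define t where "t = (if k \<le> n then hinge (\<xi> k) x else 0)"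
      define e where "e = (\<Sum>i = 1..<k. (-1) ^ i * (hinge (\<xi> i) x - 1))"
      have "hinge (\<xi> k) x \<le> hinge (\<xi> k) (3/2 * \<xi> k)" by (rule hinge_mono[OF xi_pos x_le])
      also have "\<dots> = 1/3" using xi_pos[of k] by (simp add: hinge_def)
      finally have t: "0 \<le> t" "t \<le> 1/3" using hinge_bounds[OF xi_pos] by (auto simp: t_def)
      have e: "\<bar>e\<bar> * x \<le> \<xi> k / 1000"
      proof -
        have "\<bar>e\<bar> \<le> (\<Sum>i = 1..<k. \<xi> i / x)"
          unfolding e_def
        proof (rule order_trans[OF sum_abs sum_mono])
          fix i
          show "\<bar>(-1) ^ i * (hinge (\<xi> i) x - 1)\<bar> \<le> \<xi> i / x"
            using hinge_ge[OF xi_pos x_pos, of i] hinge_bounds[OF xi_pos, of i x] by (simp add: abs_mult)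
        qed
        also have "\<dots> = (\<Sum>i = 1..<k. \<xi> i) / x" by (simp add: sum_divide_distrib)
        finally show ?thesis using sum_lower_knots[OF k(2)] x_pos by (simp add: field_simps)
      qed
      \<comment> \<open>Near the vertical axis x is small and the tail \<open>e\<close> need not be
        small. It occurs only with the squared cosine, and one of the two factors, compared with x,
        compensates exactly this.\<close>
      have "\<bar>e\<bar> * ?c \<le> 1/500"
      proof -
        have "\<bar>e\<bar> * ((\<xi> k / 2) * ?c) \<le> \<bar>e\<bar> * x"
          unfolding x_def using r c by (intro mult_left_mono mult_right_mono) auto
        with e have "\<xi> k * (\<bar>e\<bar> * ?c) \<le> \<xi> k * (1/500)" by (simp add: algebra_simps)
        then show ?thesis using xi_pos[of k] by (simp only: mult_le_cancel_left_pos)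
      qed
      moreover have "(\<bar>e\<bar> * ?c) * ?c \<le> (\<bar>e\<bar> * ?c) * 1" using c by (intro mult_left_mono) auto
      ultimately have e2: "\<bar>e\<bar> * ?c\<^sup>2 \<le> 1/500" by (simp add: power2_eq_square)
      obtain j where j: "k = Suc j" using k(1) by (cases k) auto
      have "(\<Sum>i = 1..<k. (-1) ^ i * hinge (\<xi> i) x) = (\<Sum>i = 1..<k. (-1) ^ i) + e"
        by (simp add: e_def right_diff_distrib sum_subtractf)
      then have "?s * ratio x = (if odd k then 1 else 3) - 4 * t + 4 * (?s * e)"
        unfolding split t_def j sum_minus_one_powers by (simp add: algebra_simps)
      moreover have "- \<bar>e\<bar> \<le> ?s * e" by (cases "even k") auto
      ultimately have "(if odd k then -1/3 else 5/3) - 4 * \<bar>e\<bar> \<le> ?s * ratio x"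
        using t by (auto split: if_splits)
      then have "((if odd k then -1/3 else 5/3) - 4 * \<bar>e\<bar>) * ?c\<^sup>2 \<le> ?s * ratio x * ?c\<^sup>2"
        by (intro mult_right_mono) auto
      moreover have "((if odd k then -1/3 else 5/3) - 4 * \<bar>e\<bar>) * ?c\<^sup>2 =
          (if odd k then -1/3 else 5/3) * ?c\<^sup>2 - 4 * (\<bar>e\<bar> * ?c\<^sup>2)"
        by (simp add: left_diff_distrib mult.assoc)
      ultimately show ?thesis using e2 by linarith
    qed simp
  qed
qed

text \<open>Adding m \<theta> to \<rho> gives an antiderivative of the uncorrected right-hand side,
  which grows by 2 pi m in one turn. The turn is cut at the zeros of the cosine. The lower bounds
  for the two half planes, -1/3 and 1 or 5/3 and -1, sum to 2/3 in either parity, well above the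
  errors.\<close>

lemma mean_sign:
  assumes k: "1 \<le> k" "k \<le> Suc n"
    and r: "\<And>\<theta>. \<xi> k / 2 \<le> exp (\<rho> \<theta>)" "\<And>\<theta>. exp (\<rho> \<theta>) \<le> 3/2 * \<xi> k"
    and der: "\<And>\<theta>. (\<rho> has_real_derivative rhs (\<rho> \<theta>) \<theta> - m) (at \<theta>)"
    and per: "\<And>\<theta>. \<rho> (\<theta> + 2 * pi) = \<rho> \<theta>"
  shows "0 < (-1) ^ Suc k * m"
proof -
  let ?s = "(-1) ^ Suc k :: real"
  let ?R = "if odd k then -1/3 else 5/3 :: real" and ?L = "if odd k then 1 else -1 :: real"
  define f where "f \<theta> = ?s * (\<rho> \<theta> + m * \<theta>)" for \<theta>
  have f': "(f has_real_derivative ?s * rhs (\<rho> \<theta>) \<theta>) (at \<theta>)" for \<theta>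
    unfolding f_def by (rule derivative_eq_intros der refl)+ (simp add: algebra_simps)
  have right: "(\<epsilon> * ?R / 2 + - (\<epsilon> / 100)) * (pi / 2 - - (pi / 2)) \<le> f (pi / 2) - f (- (pi / 2))"
  proof (rule DERIV_ge_cos_squared[OF _ f'])
    fix \<theta> assume "- (pi / 2) \<le> \<theta>" "\<theta> \<le> pi / 2"
    then have "0 \<le> cos \<theta>" by (intro cos_ge_zero) auto
    from rhs_sign(1)[OF k r this] show "\<epsilon> * ?R * (cos \<theta>)\<^sup>2 + - (\<epsilon> / 100) \<le> ?s * rhs (\<rho> \<theta>) \<theta>"
      by (simp add: right_diff_distrib mult.assoc)
  qed (simp_all add: cos_half_integer_pi)
  have left: "(\<epsilon> * ?L / 2 + - (\<epsilon> / 100)) * (3 * pi / 2 - pi / 2) \<le> f (3 * pi / 2) - f (pi / 2)"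
  proof (rule DERIV_ge_cos_squared[OF _ f'])
    fix \<theta> assume "pi / 2 \<le> \<theta>" "\<theta> \<le> 3 * pi / 2"
    then have "cos \<theta> \<le> 0" by (rule cos_nonpos)
    from rhs_sign(2)[OF k r this] show "\<epsilon> * ?L * (cos \<theta>)\<^sup>2 + - (\<epsilon> / 100) \<le> ?s * rhs (\<rho> \<theta>) \<theta>"
      by (simp add: right_diff_distrib mult.assoc)
  qed (simp_all add: cos_half_integer_pi)
  have "f (3 * pi / 2) - f (- (pi / 2)) = ?s * m * (2 * pi)"
    using per[of "- (pi / 2)"] by (simp add: f_def algebra_simps)
  moreover have "(\<epsilon> * ?R / 2 + - (\<epsilon> / 100)) * (pi / 2 - - (pi / 2)) +
      (\<epsilon> * ?L / 2 + - (\<epsilon> / 100)) * (3 * pi / 2 - pi / 2) = \<epsilon> * pi * (1/3 - 1/50)"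
    by (simp add: algebra_simps)
  ultimately have "\<epsilon> * pi * (1/3 - 1/50) \<le> ?s * m * (2 * pi)" using right left by linarith
  moreover have "0 < \<epsilon> * pi * (1/3 - 1/50)" using eps_pos by simp
  ultimately have "0 < ?s * m * (2 * pi)" by linarith
  then show ?thesis by (rule zero_less_mult_pos2) simp
qed

lemma ex_periodic_solution:
  assumes k: "1 \<le> k" "k \<le> n"
  obtains \<rho> where "\<And>\<theta>. (\<rho> has_real_derivative rhs (\<rho> \<theta>) \<theta>) (at \<theta>)" "\<And>\<theta>. \<rho> (\<theta> + 2 * pi) = \<rho> \<theta>"
    "\<And>\<theta>. 5/4 * \<xi> k < exp (\<rho> \<theta>)" "\<And>\<theta>. exp (\<rho> \<theta>) < \<xi> (Suc k)"
proof -
  obtain R m where m: "continuous_on UNIV m"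
    and per: "\<And>c \<theta>. R c (\<theta> + 2 * pi) = R c \<theta>"
    and der: "\<And>c \<theta>. (R c has_real_derivative rhs (R c \<theta>) \<theta> - m c) (at \<theta>)"
    and near: "\<And>c \<theta>. \<bar>R c \<theta> - c\<bar> \<le> 1/100"
    using corrected_solutions by metis
  have R_ge: "99/100 * exp c \<le> exp (R c \<theta>)" and R_le: "exp (R c \<theta>) \<le> 51/50 * exp c" for c \<theta>
  proof -
    have "exp (R c \<theta>) = exp (R c \<theta> - c) * exp c" by (simp flip: exp_add)
    moreover have "99/100 \<le> exp (R c \<theta> - c)"
      using exp_ge_add_one_self[of "R c \<theta> - c"] near[where c = c and \<theta> = \<theta>] by linarith
    moreover have "exp (R c \<theta> - c) \<le> 51/50"
    proof -
      have "R c \<theta> - c \<le> 1/100" using near[where c = c and \<theta> = \<theta>] by linarith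
      then have "exp (R c \<theta> - c) \<le> exp (1/100)" by simp
      also have "\<dots> \<le> 1 + 1/100 + (1/100)\<^sup>2" by (rule exp_bound) auto
      finally show ?thesis by (simp add: power2_eq_square)
    qed
    ultimately show "99/100 * exp c \<le> exp (R c \<theta>)" "exp (R c \<theta>) \<le> 51/50 * exp c" by simp_all
  qed
  \<comment> \<open>With relative deviations between 99/100 and 51/50, the radii at
    \<open>c1\<close> stay between 5/4 and 3/2 times the knot \<xi> k, and those at
    \<open>c2\<close> between 1/2 and 1 times the next one. Both circles thus meet the hypotheses of
    \<open>mean_sign\<close>, and everything between them lies in the annulus.\<close>
  define c1 c2 where "c1 = ln (4/3 * \<xi> k)" and "c2 = ln (3/4 * \<xi> (Suc k))"
  have c1: "exp c1 = 4/3 * \<xi> k" and c2: "exp c2 = 3/4 * \<xi> (Suc k)"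
    using xi_pos by (simp_all add: c1_def c2_def)
  have "exp c1 \<le> exp c2" unfolding c1 c2 using xi_Suc_ge[of k] xi_pos[of k] by linarith
  then have c12: "c1 \<le> c2" by simp
  have s1: "0 < (-1) ^ Suc k * m c1"
  proof (rule mean_sign[OF k(1) _ _ _ der per])
    fix \<theta>
    show "\<xi> k / 2 \<le> exp (R c1 \<theta>)" "exp (R c1 \<theta>) \<le> 3/2 * \<xi> k"
      using R_ge[where c = c1 and \<theta> = \<theta>] R_le[where c = c1 and \<theta> = \<theta>] xi_pos[of k] unfolding c1 by linarith+
  qed (use k in simp)
  have s2: "0 < (-1) ^ Suc (Suc k) * m c2"
  proof (rule mean_sign[OF _ _ _ _ der per])
    fix \<theta>
    show "\<xi> (Suc k) / 2 \<le> exp (R c2 \<theta>)" "exp (R c2 \<theta>) \<le> 3/2 * \<xi> (Suc k)"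
      using R_ge[where c = c2 and \<theta> = \<theta>] R_le[where c = c2 and \<theta> = \<theta>] xi_pos[of "Suc k"] unfolding c2 by linarith+
  qed (use k in simp_all)
  have "\<exists>c. c1 \<le> c \<and> c \<le> c2 \<and> (-1) ^ Suc (Suc k) * m c = 0"
  proof (rule IVT')
    show "(-1) ^ Suc (Suc k) * m c1 \<le> 0" using s1 by simp
    show "0 \<le> (-1) ^ Suc (Suc k) * m c2" using s2 by simp
    show "continuous_on {c1..c2} (\<lambda>c. (-1) ^ Suc (Suc k) * m c)"
      by (intro continuous_intros continuous_on_subset[OF m]) auto
  qed (rule c12)
  then obtain c where c: "c1 \<le> c" "c \<le> c2" "m c = 0" by auto
  have ce: "4/3 * \<xi> k \<le> exp c" "exp c \<le> 3/4 * \<xi> (Suc k)"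
    unfolding c1[symmetric] c2[symmetric] using c by simp_all
  show ?thesis
  proof (rule that[of "R c"])
    fix \<theta>
    show "(R c has_real_derivative rhs (R c \<theta>) \<theta>) (at \<theta>)" using der[of c \<theta>] c by simp
    show "R c (\<theta> + 2 * pi) = R c \<theta>" by (rule per)
    show "5/4 * \<xi> k < exp (R c \<theta>)"
      using R_ge[where c = c and \<theta> = \<theta>] ce xi_pos[of k] by linarith
    show "exp (R c \<theta>) < \<xi> (Suc k)"
      using R_le[where c = c and \<theta> = \<theta>] ce xi_pos[of "Suc k"] by linarith
  qed
qed

end

subsection \<open>Uniqueness in an annulus\<close>

context nested_knots
begin

text \<open>
  In the annulus between \<open>\<xi> k\<close> and \<open>\<xi> (k + 1)\<close> only the hinges of the knots up to \<open>\<xi> k\<close> are active,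
  and those of the earlier knots are negligible, being weighted with their knots.
\<close>

lemma ratio_diff:
  assumes k: "1 \<le> k" "k \<le> n" and x: "0 < x" "x \<le> y" "y \<le> \<xi> (Suc k)"
  shows "- (\<xi> k * (1 / x - 1 / y)) / 250 \<le> (-1) ^ k * (ratio y - ratio x)"
    and "\<xi> k \<le> x \<Longrightarrow> (4 - 1/250) * (\<xi> k * (1 / x - 1 / y)) \<le> (-1) ^ k * (ratio y - ratio x)"
proof -
  define d where "d i = hinge (\<xi> i) y - hinge (\<xi> i) x" for i
  define v where "v = 1 / x - 1 / y"
  define e where "e = (\<Sum>i = 1..<k. (-1) ^ i * d i)"
  have v: "0 \<le> v" using x by (simp add: v_def field_simps)
  have d: "0 \<le> d i" "d i \<le> \<xi> i * v" for i
    using hinge_diff_le(1)[OF xi_pos x(1,2)] hinge_mono[OF xi_pos x(2)] by (simp_all add: d_def v_def)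
  have "\<bar>e\<bar> \<le> (\<Sum>i = 1..<k. \<xi> i * v)"
    unfolding e_def by (rule order_trans[OF sum_abs sum_mono]) (use d in \<open>simp add: abs_mult\<close>)
  also have "\<dots> = (\<Sum>i = 1..<k. \<xi> i) * v" by (simp add: sum_distrib_right)
  also have "\<dots> \<le> (\<xi> k / 1000) * v" using sum_lower_knots[of k] k v by (intro mult_right_mono) auto
  finally have e: "\<bar>e\<bar> \<le> \<xi> k * v / 1000" by simp
  have "ratio y - ratio x = 4 * e + 4 * (-1) ^ k * d k"
    using ratio_split[of k x] ratio_split[of k y] k x
    by (simp add: e_def d_def right_diff_distrib sum_subtractf)
  then have eq: "(-1) ^ k * (ratio y - ratio x) = 4 * ((-1) ^ k * e) + 4 * d k"
    by (simp add: algebra_simps flip: power_add)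
  have abs_e: "- \<bar>e\<bar> \<le> (-1) ^ k * e" by (cases "even k") auto
  show "- (\<xi> k * (1 / x - 1 / y)) / 250 \<le> (-1) ^ k * (ratio y - ratio x)"
    unfolding eq v_def[symmetric] using abs_e e d(1)[of k] by simp
  show "(4 - 1/250) * (\<xi> k * (1 / x - 1 / y)) \<le> (-1) ^ k * (ratio y - ratio x)" if "\<xi> k \<le> x"
  proof -
    \<comment> \<open>Beyond its knot the hinge is a hyperbola and the difference is exact. The knot
      itself falls under the zero branch of \<open>hinge\<close> and is treated separately.\<close>
    have "d k = \<xi> k * v"
    proof (cases "x = \<xi> k")
      case True
      then show ?thesis using x xi_pos[of k] by (auto simp: d_def v_def hinge_def field_simps)
    next
      case False
      then show ?thesis using that x xi_pos[of k] by (simp add: d_def v_def hinge_def right_diff_distrib)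
    qed
    then show ?thesis unfolding eq v_def[symmetric] using abs_e e by (simp add: algebra_simps)
  qed
qed

text \<open>For positive cosine, the difference of 1/x times the squared cosine is the difference of
  1/r times the cosine, so there is no singularity at the vertical axis. The constant 125 is 250
  halved by the bound 2 for the speed factor, and 3/2 lies below (4 - 1/250) (4/5) (1/2). On the
  left half plane the ratio is constant.\<close>

lemma rhs_gap:
  assumes k: "1 \<le> k" "k \<le> n" and ab: "a \<le> b" "5/4 * \<xi> k \<le> exp a" "exp b \<le> \<xi> (Suc k)"
  shows "0 \<le> cos \<theta> \<Longrightarrow>
      - (\<epsilon> * \<xi> k / 125 * (exp (- a) - exp (- b))) \<le> (-1) ^ k * (rhs b \<theta> - rhs a \<theta>)"
    and "4/5 \<le> cos \<theta> \<Longrightarrow>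
      3/2 * \<epsilon> * \<xi> k * (exp (- a) - exp (- b)) \<le> (-1) ^ k * (rhs b \<theta> - rhs a \<theta>)"
    and "cos \<theta> \<le> 0 \<Longrightarrow> rhs b \<theta> = rhs a \<theta>"
proof -
  let ?c = "cos \<theta>"
  define W where "W = 1 / (speed b \<theta> * speed a \<theta>)"
  have W: "1/2 \<le> W" "W \<le> 2" using speed_prod_bounds[of b \<theta> a] by (simp_all add: W_def)
  define x y where "x = exp a * ?c" and "y = exp b * ?c"
  define \<Delta> where "\<Delta> = exp (- a) - exp (- b)"
  have \<Delta>: "0 \<le> \<Delta>" using ab by (simp add: \<Delta>_def)
  have diff: "rhs b \<theta> - rhs a \<theta> = \<epsilon> * (ratio y - ratio x) * ?c\<^sup>2 * W"
    unfolding rhs_diff x_def y_def W_def by (simp add: algebra_simps)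
  define P where "P = \<epsilon> * \<xi> k * \<Delta>"
  have P: "0 \<le> P" using eps_pos xi_pos[of k] \<Delta> by (simp add: P_def)
  have diff2: "(-1) ^ k * (rhs b \<theta> - rhs a \<theta>) = \<epsilon> * (((-1) ^ k * (ratio y - ratio x)) * ?c\<^sup>2) * W"
    unfolding diff by (simp only: mult_ac)
  have xy: "0 < x" "x \<le> y" "y \<le> \<xi> (Suc k)" "(1 / x - 1 / y) * ?c\<^sup>2 = \<Delta> * ?c" if "0 < ?c"
  proof -
    show "0 < x" "x \<le> y" using that ab by (simp_all add: x_def y_def)
    have "y \<le> \<xi> (Suc k) * 1" unfolding y_def using ab that xi_pos[of "Suc k"] by (intro mult_mono) auto
    then show "y \<le> \<xi> (Suc k)" by simp
    show "(1 / x - 1 / y) * ?c\<^sup>2 = \<Delta> * ?c"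
      using that by (simp add: x_def y_def \<Delta>_def exp_minus field_simps power2_eq_square)
  qed
  show "- (\<epsilon> * \<xi> k / 125 * (exp (- a) - exp (- b))) \<le> (-1) ^ k * (rhs b \<theta> - rhs a \<theta>)" if "0 \<le> ?c"
  proof (cases "?c = 0")
    case True
    then show ?thesis using P unfolding diff by (simp add: P_def \<Delta>_def)
  next
    case False
    with that have c: "0 < ?c" by simp
    have "(- (\<xi> k * (1 / x - 1 / y)) / 250) * ?c\<^sup>2 \<le> ((-1) ^ k * (ratio y - ratio x)) * ?c\<^sup>2"
      by (rule mult_right_mono[OF ratio_diff(1)[OF k xy(1-3)[OF c]]]) simp
    then have "\<epsilon> * ((- (\<xi> k * (1 / x - 1 / y)) / 250) * ?c\<^sup>2) * W \<le> (-1) ^ k * (rhs b \<theta> - rhs a \<theta>)"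
      unfolding diff2 using W eps_pos by (intro mult_right_mono[of _ _ W] mult_left_mono[of _ _ \<epsilon>]) auto
    also have "\<epsilon> * ((- (\<xi> k * (1 / x - 1 / y)) / 250) * ?c\<^sup>2) * W =
        - (\<epsilon> * \<xi> k * ((1 / x - 1 / y) * ?c\<^sup>2) * W) / 250" by simp
    also have "\<dots> = - (P * (?c * W)) / 250" unfolding xy(4)[OF c] by (simp add: P_def)
    finally have "- (P * (?c * W)) / 250 \<le> (-1) ^ k * (rhs b \<theta> - rhs a \<theta>)" .
    moreover have "P * (?c * W) \<le> P * (1 * 2)" using P W c by (intro mult_left_mono mult_mono) auto
    ultimately show ?thesis by (simp add: P_def \<Delta>_def)
  qed
  show "3/2 * \<epsilon> * \<xi> k * (exp (- a) - exp (- b)) \<le> (-1) ^ k * (rhs b \<theta> - rhs a \<theta>)" if "4/5 \<le> ?c"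
  proof -
    have c: "0 < ?c" using that by simp
    have "(5/4 * \<xi> k) * (4/5) \<le> x" unfolding x_def using that ab xi_pos[of k] by (intro mult_mono) auto
    then have "\<xi> k \<le> x" by simp
    note ratio_diff(2)[OF k xy(1-3)[OF c] this]
    then have "((4 - 1/250) * (\<xi> k * (1 / x - 1 / y))) * ?c\<^sup>2 \<le> ((-1) ^ k * (ratio y - ratio x)) * ?c\<^sup>2"
      by (rule mult_right_mono) simp
    then have "\<epsilon> * (((4 - 1/250) * (\<xi> k * (1 / x - 1 / y))) * ?c\<^sup>2) * W \<le> (-1) ^ k * (rhs b \<theta> - rhs a \<theta>)"
      unfolding diff2 using W eps_pos by (intro mult_right_mono[of _ _ W] mult_left_mono[of _ _ \<epsilon>]) auto
    also have "\<epsilon> * (((4 - 1/250) * (\<xi> k * (1 / x - 1 / y))) * ?c\<^sup>2) * W =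
        (4 - 1/250) * (\<epsilon> * \<xi> k * ((1 / x - 1 / y) * ?c\<^sup>2) * W)" by simp
    also have "\<dots> = (4 - 1/250) * (P * (?c * W))" unfolding xy(4)[OF c] by (simp add: P_def)
    finally have "(4 - 1/250) * (P * (?c * W)) \<le> (-1) ^ k * (rhs b \<theta> - rhs a \<theta>)" .
    moreover have "P * (4/5 * (1/2)) \<le> P * (?c * W)" using P W that by (intro mult_left_mono mult_mono) auto
    ultimately have "3/2 * P \<le> (-1) ^ k * (rhs b \<theta> - rhs a \<theta>)" using P by simp
    then show ?thesis by (simp add: P_def \<Delta>_def mult.assoc)
  qed
  show "rhs b \<theta> = rhs a \<theta>" if "?c \<le> 0"
  proof -
    have "x \<le> 0" "y \<le> 0" using that by (simp_all add: x_def y_def mult_nonneg_nonpos)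
    then show ?thesis using diff by (simp add: ratio_nonpos)
  qed
qed

text \<open>With u0 the initial difference of reciprocal radii, the sector \<bar>\<theta>\<bar>
  \<le> pi/6 contributes at least pi P u0 / 4. The rest of the right half plane loses at most pi P
  u0 / 125, and the left half plane nothing. The direction alternates with the parity of
  \<open>k\<close>.\<close>

lemma gap_monotone:
  assumes k: "1 \<le> k" "k \<le> n"
    and f: "\<And>\<theta>. (f has_real_derivative rhs (f \<theta>) \<theta>) (at \<theta>)"
      "\<And>\<theta>. 5/4 * \<xi> k \<le> exp (f \<theta>)" "\<And>\<theta>. exp (f \<theta>) \<le> \<xi> (Suc k)"
    and g: "\<And>\<theta>. (g has_real_derivative rhs (g \<theta>) \<theta>) (at \<theta>)"
      "\<And>\<theta>. 5/4 * \<xi> k \<le> exp (g \<theta>)" "\<And>\<theta>. exp (g \<theta>) \<le> \<xi> (Suc k)"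
    and init: "f (- (pi / 2)) < g (- (pi / 2))"
  shows "(-1) ^ k * (g (- (pi / 2)) - f (- (pi / 2))) < (-1) ^ k * (g (3 * pi / 2) - f (3 * pi / 2))"
proof -
  define u where "u \<theta> = exp (- f \<theta>) - exp (- g \<theta>)" for \<theta>
  define u0 where "u0 = u (- (pi / 2))"
  define d where "d \<theta> = (-1) ^ k * (g \<theta> - f \<theta>)" for \<theta>
  have d': "(d has_real_derivative (-1) ^ k * (rhs (g \<theta>) \<theta> - rhs (f \<theta>) \<theta>)) (at \<theta>)" for \<theta>
    unfolding d_def by (intro DERIV_cmult DERIV_diff f g)
  have u0: "0 < u0" using init by (simp add: u0_def u_def)
  define P where "P = \<epsilon> * \<xi> k"
  have P: "0 < P" using eps_pos xi_pos[of k] by (simp add: P_def)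
  have window: "u0 / 2 \<le> u \<theta>" "u \<theta> \<le> 3/2 * u0" "f \<theta> \<le> g \<theta>"
    if "- (pi / 2) \<le> \<theta>" "\<theta> \<le> 3 * pi / 2" for \<theta>
  proof -
    have \<theta>: "- (pi / 2) \<le> \<theta>" "\<theta> \<le> - (pi / 2) + 2 * pi" using that by auto
    show "u0 / 2 \<le> u \<theta>" "u \<theta> \<le> 3/2 * u0"
      using inv_radius_close[OF f(1) g(1) \<theta>] u0 unfolding u0_def u_def by argo+
    show "f \<theta> \<le> g \<theta>" using solution_order(1)[OF f(1) g(1) \<theta> init] by simp
  qed
  have outer: "- (P / 125 * (3/2 * u0)) \<le> (-1) ^ k * (rhs (g \<theta>) \<theta> - rhs (f \<theta>) \<theta>)"
    if "- (pi / 2) \<le> \<theta>" "\<theta> \<le> pi / 2" for \<theta>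
  proof -
    have \<theta>: "- (pi / 2) \<le> \<theta>" "\<theta> \<le> 3 * pi / 2" using that by auto
    have "0 \<le> cos \<theta>" using that by (rule cos_ge_zero)
    from rhs_gap(1)[OF k window(3)[OF \<theta>] f(2) g(3) this]
    have "- (P / 125 * u \<theta>) \<le> (-1) ^ k * (rhs (g \<theta>) \<theta> - rhs (f \<theta>) \<theta>)" by (simp add: P_def u_def)
    moreover have "P / 125 * u \<theta> \<le> P / 125 * (3/2 * u0)"
      using window(2)[OF \<theta>] P by (intro mult_left_mono) auto
    ultimately show ?thesis by linarith
  qed
  have inner: "3/2 * P * (u0 / 2) \<le> (-1) ^ k * (rhs (g \<theta>) \<theta> - rhs (f \<theta>) \<theta>)"
    if "- (pi / 6) \<le> \<theta>" "\<theta> \<le> pi / 6" for \<theta>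
  proof -
    have \<theta>: "- (pi / 2) \<le> \<theta>" "\<theta> \<le> 3 * pi / 2" using that pi_gt_zero by linarith+
    from rhs_gap(2)[OF k window(3)[OF \<theta>] f(2) g(3) cos_ge_4_5[OF that]]
    have "3/2 * P * u \<theta> \<le> (-1) ^ k * (rhs (g \<theta>) \<theta> - rhs (f \<theta>) \<theta>)" by (simp add: P_def u_def mult.assoc)
    moreover have "3/2 * P * (u0 / 2) \<le> 3/2 * P * u \<theta>"
      using window(1)[OF \<theta>] P by (intro mult_left_mono) auto
    ultimately show ?thesis by linarith
  qed
  have 1: "- (P / 125 * (3/2 * u0)) * (- (pi / 6) - - (pi / 2)) \<le> d (- (pi / 6)) - d (- (pi / 2))"
    by (rule DERIV_ge_imp_diff_ge[OF _ d' outer]) auto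
  have 2: "3/2 * P * (u0 / 2) * (pi / 6 - - (pi / 6)) \<le> d (pi / 6) - d (- (pi / 6))"
    by (rule DERIV_ge_imp_diff_ge[OF _ d' inner]) auto
  have 3: "- (P / 125 * (3/2 * u0)) * (pi / 2 - pi / 6) \<le> d (pi / 2) - d (pi / 6)"
    by (rule DERIV_ge_imp_diff_ge[OF _ d' outer]) auto
  have 4: "0 * (3 * pi / 2 - pi / 2) \<le> d (3 * pi / 2) - d (pi / 2)"
  proof (rule DERIV_ge_imp_diff_ge[OF _ d'])
    fix \<theta> assume \<theta>: "pi / 2 \<le> \<theta>" "\<theta> \<le> 3 * pi / 2"
    then have "f \<theta> \<le> g \<theta>" using pi_gt_zero by (intro window(3)) linarith+
    from rhs_gap(3)[OF k this f(2) g(3) cos_nonpos[OF \<theta>]]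
    show "0 \<le> (-1) ^ k * (rhs (g \<theta>) \<theta> - rhs (f \<theta>) \<theta>)" by simp
  qed auto
  have "0 < P * u0 * pi" using P u0 by simp
  then have "0 < - (P / 125 * (3/2 * u0)) * (- (pi / 6) - - (pi / 2)) +
      3/2 * P * (u0 / 2) * (pi / 6 - - (pi / 6)) + - (P / 125 * (3/2 * u0)) * (pi / 2 - pi / 6)"
    by (simp add: field_simps)
  then have "d (- (pi / 2)) < d (3 * pi / 2)" using 1 2 3 4 by linarith
  then show ?thesis by (simp add: d_def)
qed

text \<open>Order is preserved from turn to turn, so the signed logarithmic gap increases strictly
  at every turn. After m turns it would have to return to its initial value.\<close>

lemma periodic_solutions_not_ordered:
  assumes k: "1 \<le> k" "k \<le> n"
    and f: "\<And>\<theta>. (f has_real_derivative rhs (f \<theta>) \<theta>) (at \<theta>)"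
      "\<And>\<theta>. 5/4 * \<xi> k \<le> exp (f \<theta>)" "\<And>\<theta>. exp (f \<theta>) \<le> \<xi> (Suc k)"
    and g: "\<And>\<theta>. (g has_real_derivative rhs (g \<theta>) \<theta>) (at \<theta>)"
      "\<And>\<theta>. 5/4 * \<xi> k \<le> exp (g \<theta>)" "\<And>\<theta>. exp (g \<theta>) \<le> \<xi> (Suc k)"
    and per: "\<And>\<theta>. f (\<theta> + of_nat m * (2 * pi)) = f \<theta>" "\<And>\<theta>. g (\<theta> + of_nat m * (2 * pi)) = g \<theta>"
    and "0 < m"
  shows "\<not> f (- (pi / 2)) < g (- (pi / 2))"
proof
  assume init: "f (- (pi / 2)) < g (- (pi / 2))"
  define p where "p j = - (pi / 2) + of_nat j * (2 * pi)" for j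
  define D where "D j = (-1) ^ k * (g (p j) - f (p j))" for j
  have p_Suc: "p (Suc j) = 3 * pi / 2 + of_nat j * (2 * pi)" for j
    by (simp add: p_def algebra_simps)
  have lt: "f (p j) < g (p j)" for j
  proof (induction j)
    case (Suc j)
    have "p (Suc j) = - (pi / 2) + 2 * pi + of_nat j * (2 * pi)" by (simp add: p_def algebra_simps)
    with solution_order(1)[OF DERIV_solution_shift[OF f(1)] DERIV_solution_shift[OF g(1)],
        of "- (pi / 2)" "- (pi / 2) + 2 * pi" j j] Suc
    show ?case by (simp add: p_def)
  qed (use init in \<open>simp add: p_def\<close>)
  have step: "D j < D (Suc j)" for j
    using gap_monotone[OF k DERIV_solution_shift[OF f(1)] f(2,3) DERIV_solution_shift[OF g(1)] g(2,3), of j j]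
      lt[of j] unfolding D_def p_Suc by (simp add: p_def)
  have "D 0 < D m" using step \<open>0 < m\<close> by (rule lift_Suc_mono_less)
  moreover have "D m = D 0" using per[of "- (pi / 2)"] by (simp add: D_def p_def)
  ultimately show False by simp
qed

text \<open>The inner factor 5/4 is the reciprocal of the bound 4/5 for the cosine on
  \<bar>\<theta>\<bar> \<le> pi/6: on that sector x is then beyond the knot \<xi> k and its hinge is
  active. Strict inequalities make the set open, so it can serve as the isolating
  neighbourhood.\<close>

definition annulus :: "nat \<Rightarrow> (real \<times> real) set" where
  "annulus k = {p. 5/4 * \<xi> k < norm p \<and> norm p < \<xi> (Suc k)}"

lemma open_annulus: "open (annulus k)"
  unfolding annulus_def by (intro open_Collect_conj open_Collect_less continuous_intros)

lemma annulus_disjoint: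
  assumes "p \<in> annulus j" "p \<in> annulus k"
  shows "j = k"
proof -
  have *: "\<not> j < k" if "p \<in> annulus j" "p \<in> annulus k" for j k
  proof
    assume "j < k"
    then have "\<xi> (Suc j) \<le> \<xi> k" by (intro xi_mono) simp
    then show False using that xi_pos[of k] by (simp add: annulus_def)
  qed
  show ?thesis using *[OF assms] *[OF assms(2,1)] by simp
qed

lemma ex_limit_cycle:
  assumes k: "1 \<le> k" "k \<le> n"
  shows "\<exists>C. limit_cycle (lienard_field F) C \<and> C \<noteq> {} \<and> C \<subseteq> annulus k"
proof -
  obtain \<rho> where der: "\<And>\<theta>. (\<rho> has_real_derivative rhs (\<rho> \<theta>) \<theta>) (at \<theta>)"
    and per: "\<And>\<theta>. \<rho> (\<theta> + 2 * pi) = \<rho> \<theta>"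
    and r: "\<And>\<theta>. 5/4 * \<xi> k < exp (\<rho> \<theta>)" "\<And>\<theta>. exp (\<rho> \<theta>) < \<xi> (Suc k)"
    using ex_periodic_solution[OF k] by blast
  \<comment> \<open>Provides \<open>plus_of_nat\<close>: \<rho> also has period 2 pi m, the period
    of an arbitrary competitor that closes after m turns.\<close>
  interpret periodic_fun_simple \<rho> "2 * pi" by standard (rule per)
  have F_eq: "F = (\<lambda>x. x * (\<epsilon> * ratio x))" by (simp add: F_def fun_eq_iff)
  define C where "C = range (polar \<rho>)"
  have "C \<subseteq> annulus k" using r by (auto simp: C_def annulus_def norm_polar)
  have unique: "C' = C" if C': "periodic_orbit (lienard_field F) C'" "C' \<subseteq> annulus k" for C'
  proof -
    have "0 \<notin> C'" using C'(2) xi_pos[of k] by (auto simp: annulus_def)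
    obtain \<sigma> and m :: nat where m: "0 < m"
      and \<sigma>: "\<And>\<theta>. (\<sigma> has_real_derivative rhs (\<sigma> \<theta>) \<theta>) (at \<theta>)"
        "\<And>\<theta>. \<sigma> (\<theta> + of_nat m * (2 * pi)) = \<sigma> \<theta>" and C'_eq: "C' = range (polar \<sigma>)"
      by (rule periodic_orbit_is_polar[OF C'(1)[unfolded F_eq] \<open>0 \<notin> C'\<close>]) (rule that)
    have "polar \<sigma> \<theta> \<in> annulus k" for \<theta> using C'(2) C'_eq by auto
    then have r': "5/4 * \<xi> k < exp (\<sigma> \<theta>)" "exp (\<sigma> \<theta>) < \<xi> (Suc k)" for \<theta>
      by (simp_all add: annulus_def norm_polar)
    note bounds = r[THEN less_imp_le] r'[THEN less_imp_le]
    have "\<not> \<rho> (- (pi / 2)) < \<sigma> (- (pi / 2))"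
      by (rule periodic_solutions_not_ordered[OF k der bounds(1,2) \<sigma>(1) bounds(3,4) plus_of_nat \<sigma>(2) m])
    moreover have "\<not> \<sigma> (- (pi / 2)) < \<rho> (- (pi / 2))"
      by (rule periodic_solutions_not_ordered[OF k \<sigma>(1) bounds(3,4) der bounds(1,2) \<sigma>(2) plus_of_nat m])
    ultimately have "\<sigma> (- (pi / 2)) = \<rho> (- (pi / 2))" by simp
    from solution_eqI[OF \<sigma>(1) der \<sigma>(2) plus_of_nat m this] show ?thesis by (simp add: C'_eq C_def)
  qed
  have "limit_cycle (lienard_field F) C"
    unfolding limit_cycle_def
  proof (intro conjI exI[of _ "annulus k"] allI impI)
    show "periodic_orbit (lienard_field F) C"
      unfolding F_eq C_def by (rule periodic_orbit_polar[OF der per])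
  qed (use open_annulus \<open>C \<subseteq> annulus k\<close> unique in auto)
  with \<open>C \<subseteq> annulus k\<close> show ?thesis by (auto simp: C_def)
qed

section \<open>Normal form of \<open>F\<close>, its folds and the absence of jumps\<close>

lemma F_abs:
  "F x = (\<epsilon> + 2 * \<epsilon> * (\<Sum>i = 1..n. (-1) ^ i)) * x - 2 * \<epsilon> * (\<Sum>i = 1..n. (-1) ^ i * \<xi> i)
    + (\<Sum>i = 1..n. 2 * \<epsilon> * (-1) ^ i * \<bar>x - \<xi> i\<bar>)"
proof -
  have "F x = \<epsilon> * x + (\<Sum>i = 1..n. 4 * \<epsilon> * (-1) ^ i * (x * hinge (\<xi> i) x))"
    unfolding F_def ratio_def distrib_left sum_distrib_left mult_1_right
    by (intro arg_cong2[where f = "(+)"] sum.cong) simp_all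
  also have "(\<Sum>i = 1..n. 4 * \<epsilon> * (-1) ^ i * (x * hinge (\<xi> i) x)) =
      (\<Sum>i = 1..n. 2 * \<epsilon> * (-1) ^ i * x - 2 * \<epsilon> * ((-1) ^ i * \<xi> i) + 2 * \<epsilon> * (-1) ^ i * \<bar>x - \<xi> i\<bar>)"
    unfolding mult_hinge[OF xi_pos] by (rule sum.cong) (simp_all add: field_simps)
  also have "\<dots> = 2 * \<epsilon> * (\<Sum>i = 1..n. (-1) ^ i) * x - 2 * \<epsilon> * (\<Sum>i = 1..n. (-1) ^ i * \<xi> i)
      + (\<Sum>i = 1..n. 2 * \<epsilon> * (-1) ^ i * \<bar>x - \<xi> i\<bar>)"
    by (simp only: sum.distrib sum_subtractf sum_distrib_left sum_distrib_right)
  finally show ?thesis by (simp add: distrib_right)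
qed

lemma strict_mono_on_xi: "strict_mono_on A \<xi>"
  by (intro strict_mono_onI xi_strict_mono)

lemma piecewise_linear_F: "piecewise_linear n F"
  unfolding piecewise_linear_def
proof (intro exI conjI ballI allI)
  fix x
  show "F x = (\<epsilon> + 2 * \<epsilon> * (\<Sum>i = 1..n. (-1) ^ i)) * x + - (2 * \<epsilon> * (\<Sum>i = 1..n. (-1) ^ i * \<xi> i))
    + (\<Sum>i = 1..n. (2 * \<epsilon> * (-1) ^ i) * \<bar>x - \<xi> i\<bar>) + (\<Sum>i = 1..n. 0 * sgn (x - \<xi> i))"
    unfolding F_abs[of x] by simp
  show "strict_mono_on {1..n} \<xi>" by (rule strict_mono_on_xi)
  fix i
  show "((2 * \<epsilon> * (-1) ^ i)\<^sup>2 + 0\<^sup>2) * \<xi> i \<noteq> 0" using eps_pos xi_pos[of i] by simp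
qed

lemma card_fold_points_F: "card (fold_points F) = n"
proof -
  have inj: "inj_on \<xi> {1..n}" by (rule strict_mono_on_imp_inj_on[OF strict_mono_on_xi])
  have "fold_points F = (\<lambda>i. (\<xi> i, F (\<xi> i))) ` {1..n}"
  proof (rule fold_points_abs_sum)
    show "F x = (\<epsilon> + 2 * \<epsilon> * (\<Sum>i = 1..n. (-1) ^ i)) * x + - (2 * \<epsilon> * (\<Sum>i = 1..n. (-1) ^ i * \<xi> i))
        + (\<Sum>i = 1..n. (2 * \<epsilon> * (-1) ^ i) * \<bar>x - \<xi> i\<bar>)" for x
      using F_abs[of x] by simp
    show "2 * \<epsilon> * (-1) ^ i \<noteq> 0" for i :: nat using eps_pos by simp
  qed (rule finite_atLeastAtMost inj)+
  moreover have "inj_on (\<lambda>i. (\<xi> i, F (\<xi> i))) {1..n}"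
    by (rule inj_onI) (use inj in \<open>simp add: inj_on_eq_iff\<close>)
  ultimately have "card (fold_points F) = card {1..n}" using card_image by metis
  then show ?thesis by simp
qed

lemma jump_points_F: "jump_points F = {}"
  unfolding F_def[abs_def] by (intro jump_points_continuous continuous_intros q_cont)

end

theorem theorem2:
  fixes n :: nat
  assumes "n \<ge> 1"
  shows "\<exists>F :: real \<Rightarrow> real.
           piecewise_linear n F \<and>
           card (fold_points F) = n \<and>
           jump_points F = {} \<and>
           (\<exists>L. finite L \<and> card L \<ge> n \<and> (\<forall>C\<in>L. limit_cycle (lienard_field F) C))"
proof -
  interpret nested_knots n .
  obtain C where C: "\<And>k. k \<in> {1..n} \<Longrightarrow> limit_cycle (lienard_field F) (C k) \<and> C k \<noteq> {} \<and> C k \<subseteq> annulus k"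
    using ex_limit_cycle by (metis atLeastAtMost_iff)
  \<comment> \<open>The cycles lie in pairwise disjoint annuli; being nonempty, they are distinct as
    sets.\<close>
  have "inj_on C {1..n}"
  proof (rule inj_onI)
    fix j k assume jk: "j \<in> {1..n}" "k \<in> {1..n}" "C j = C k"
    then obtain p where "p \<in> C j" "p \<in> C k" using C[of j] by auto
    then show "j = k" using C jk(1,2) annulus_disjoint by blast
  qed
  then have "finite (C ` {1..n}) \<and> n \<le> card (C ` {1..n}) \<and> (\<forall>C\<in>C ` {1..n}. limit_cycle (lienard_field F) C)"
    using C by (simp add: card_image)
  then show ?thesis
    by (intro exI[of _ F] conjI exI[of _ "C ` {1..n}"] piecewise_linear_F card_fold_points_F
        jump_points_F) simp_all
qed

end
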